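(* Let $2\leq k\leq n$, let $f:\Lambda^{k}(\mathbb{R}^n)\rightarrow\mathbb{R}$, and let $\pi:\mathbb{R}^{\binom{n}{k-1}\times n}\rightarrow\Lambda^{k}(\mathbb{R}^n)$ be the projection map. Then the following equivalences hold: \begin{align*} f\text{ is ext. one convex }&\Longleftrightarrow\ f\circ\pi\text{ is rank one convex},\\ f\text{ is ext. quasiconvex }&\Longleftrightarrow\ f\circ\pi\text{ is quasiconvex},\\ f\text{ is ext. polyconvex }&\Longleftrightarrow\ f\circ\pi\text{ is polyconvex}. \end{align*}
   Context: $\Lambda^k=\Lambda^k(\mathbb{R}^n)$ denotes the space of alternating $k$-linear forms on $\mathbb{R}^n$, with $\Lambda^0=\mathbb{R}$ and $\Lambda^k=\{0\}$ for $k>n$. $\{e^1,\dots,e^n\}$ is the standard basis of $\Lambda^1\cong\mathbb{R}^n$. $\mathcal{T}^k$ is the set of multiindices $I=(i_1,\dots,i_k)$ with $1\le i_1<\dots<i_k\le n$, and $e^I=e^{i_1}\wedge\dots\wedge e^{i_k}$, so that $\{e^I\}_{I\in\mathcal{T}^k}$ is a basis of $\Lambda^k$. For $\xi\in\Lambda^k$, $\xi^s=\xi\wedge\dots\wedge\xi$ ($s$ times) is the $s$-th wedge power. $[x]$ is the integer part of $x$. Projection map: write $\Xi\in\mathbb{R}^{\binom{n}{k-1}\times n}$ as $\Xi=(\Xi^I_i)^{I\in\mathcal{T}^{k-1}}_{i\in\{1,\dots,n\}}$, with rows indexed by the multiindices $I\in\mathcal{T}^{k-1}$ in alphabetical order and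 columns indexed by $i$. Put $\Xi_i=\sum_{I\in\mathcal{T}^{k-1}}\Xi_i^I e^I\in\Lambda^{k-1}$. Then $\pi$ is the linear map $\pi(\Xi)=\sum_{i=1}^n\Xi_i\wedge e^i$. Exterior convexity. Let $f:\Lambda^k\to\mathbb{R}$. (i) $f$ is ext. one convex if $t\mapsto f(\xi+t\,\alpha\wedge\beta)$ is convex on $\mathbb{R}$ for every $\xi\in\Lambda^k$, $\alpha\in\Lambda^{k-1}$, $\beta\in\Lambda^1$. (ii) $f$ is ext. quasiconvex if it is Borel measurable and locally bounded and $\int_\Omega f(\xi+d\omega)\ge f(\xi)\operatorname{meas}\Omega$ for every bounded open set $\Omega\subset\mathbb{R}^n$, every $\xi\in\Lambda^k$ and every $\omega\in W_0^{1,\infty}(\Omega;\Lambda^{k-1})$, where $d$ is the exterior derivative. (iii) $f$ is ext. polyconvex if there is a convex function $F:\Lambda^k\times\Lambda^{2k}\times\dots\times\Lambda^{[n/k]k}\to\mathbb{R}$ such that $f(\xi)=F(\xi,\xi^2,\dots,\xi^{[n/k]})$ for all $\xi\in\Lambda^k$. Classical notions. Let $\phi:\mathbb{R}^{N\times n}\to\mathbb{R}$ with $N=\binom{n}{k-1}$. $\phi$ is rank one convex if $t\mapsto\phi(X+t\,a\otimes b)$ is convex for all $X\in\mathbb{R}^{N\times n}$, $a\in\mathbb{R}^N$, $b\in\mathbb{R}^n$. $\phi$ is quasiconvex if it is Borel measurable and locally bounded and $\int_\Omega\phi(X+\nabla u)\ge\phi(X)\operatorname{meas}\Omega$ for every bounded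 open $\Omega\subset\mathbb{R}^n$, $X\in\mathbb{R}^{N\times n}$ and $u\in W^{1,\infty}_0(\Omega;\mathbb{R}^N)$. $\phi$ is polyconvex if there is a convex function $G$ such that $\phi(X)=G(X,\operatorname{adj}_2X,\dots,\operatorname{adj}_{\min\{N,n\}}X)$ for all $X$, where $\operatorname{adj}_sX\in\mathbb{R}^{\binom{N}{s}\times\binom{n}{s}}$ is the matrix of all $s\times s$ minors of $X$ and $G$ is defined on the product of the spaces $\mathbb{R}^{\binom Ns\times\binom ns}$, $1\le s\le\min\{N,n\}$. *)

theory Defs
  imports
    "HOL-Analysis.Analysis"
    "HOL-Library.Function_Algebras"
    "HOL-Library.List_Lexorder"
begin

section \<open>Pointwise vector space structure on functions\<close>

text \<open>Forms are real-valued functions; their sum and zero come from Function_Algebras,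
  and only the scalar multiplication has to be added.\<close>

instantiation "fun" :: (type, real_vector) real_vector
begin

definition scaleR_fun :: "real \<Rightarrow> ('a \<Rightarrow> 'b) \<Rightarrow> 'a \<Rightarrow> 'b"
  where "scaleR_fun c f = (\<lambda>x. c *\<^sub>R f x)"

instance
  by standard (simp_all add: scaleR_fun_def fun_eq_iff scaleR_add_right scaleR_add_left)

end

section \<open>Alternating forms\<close>

text \<open>A \<open>k\<close>-form takes its arguments as a list of \<open>k\<close> vectors and is extended by
  \<open>0\<close> to lists of any other length. The topology on forms is the product topology of
  the function space; on the finite-dimensional subspaces \<open>alt_forms k\<close> it induces the
  usual topology. A 0-form is determined by its value at the empty list.\<close>

type_synonym 'n form = "(real^'n) list \<Rightarrow> real"

definition alt_forms :: "nat \<Rightarrow> 'n::finite form set" where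
  "alt_forms k = {\<xi>.
     (\<forall>vs. length vs \<noteq> k \<longrightarrow> \<xi> vs = 0) \<and>
     (\<forall>vs i. length vs = k \<longrightarrow> i < k \<longrightarrow> linear (\<lambda>x. \<xi> (vs[i := x]))) \<and>
     (\<forall>vs i j. length vs = k \<longrightarrow> i < j \<longrightarrow> j < k \<longrightarrow> vs ! i = vs ! j \<longrightarrow> \<xi> vs = 0)}"

text \<open>The sign of the shuffle that moves the positions in \<open>S\<close> to the front.\<close>

definition shuffle_sign :: "nat set \<Rightarrow> real" where
  "shuffle_sign S = (-1) ^ card {(i, j). i \<in> S \<and> j \<notin> S \<and> j < i}"

text \<open>For a \<open>p\<close>-form \<open>\<alpha>\<close> and a \<open>q\<close>-form \<open>\<beta>\<close> only the sets \<open>S\<close> of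
  cardinality \<open>p\<close> and only lists \<open>vs\<close> of length \<open>p + q\<close> contribute, so this is the sum
  over the \<open>(p, q)\<close>-shuffles, i.e. \<open>1/(p! q!)\<close> times the signed sum over all permutations.\<close>

definition wedge :: "'n::finite form \<Rightarrow> 'n form \<Rightarrow> 'n form"  (infixr "\<and>\<^sub>w" 72) where
  "\<alpha> \<and>\<^sub>w \<beta> = (\<lambda>vs. \<Sum>S\<in>Pow {..<length vs}.
     shuffle_sign S * \<alpha> (nths vs S) * \<beta> (nths vs (- S)))"

definition unit_form :: "'n::finite form" where
  "unit_form vs = (if vs = [] then 1 else 0)"

primrec wedge_power :: "'n::finite form \<Rightarrow> nat \<Rightarrow> 'n form" where
  "wedge_power \<xi> 0 = unit_form"
| "wedge_power \<xi> (Suc s) = \<xi> \<and>\<^sub>w wedge_power \<xi> s"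

definition multi_indices :: "nat \<Rightarrow> 'a::{finite,linorder} list set" where
  "multi_indices k = {I. length I = k \<and> sorted_wrt (<) I}"

definition dual_basis :: "'n::finite \<Rightarrow> 'n form" where
  "dual_basis i vs = (if length vs = 1 then hd vs $ i else 0)"

primrec basis_form :: "'n::finite list \<Rightarrow> 'n form" where
  "basis_form [] = unit_form"
| "basis_form (i # I) = dual_basis i \<and>\<^sub>w basis_form I"

section \<open>The projection map\<close>

text \<open>The rows of an \<open>N \<times> n\<close> matrix, \<open>N = n choose (k - 1)\<close>, are numbered by an
  arbitrary linearly ordered type \<open>'N\<close> with \<open>N\<close> elements. The row \<open>r\<close> belongs to the
  multiindex with the same rank in the alphabetical (lexicographic) order.\<close>

definition row_index :: "nat \<Rightarrow> 'N::{finite,linorder} \<Rightarrow> 'n::{finite,linorder} list" where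
  "row_index k r = sorted_list_of_set (multi_indices (k - 1)) ! card {r'. r' < r}"

definition proj ::
  "nat \<Rightarrow> real^'n::{finite,linorder}^'N::{finite,linorder} \<Rightarrow> 'n form" where
  "proj k X = (\<Sum>i\<in>UNIV. (\<Sum>r\<in>UNIV. (X $ r $ i) *\<^sub>R basis_form (row_index k r)) \<and>\<^sub>w dual_basis i)"

section \<open>Sobolev spaces\<close>

primrec C_diff :: "nat \<Rightarrow> (real^'n::finite \<Rightarrow> real) \<Rightarrow> bool" where
  "C_diff 0 \<phi> \<longleftrightarrow> continuous_on UNIV \<phi>"
| "C_diff (Suc m) \<phi> \<longleftrightarrow> (\<forall>x. \<phi> differentiable (at x)) \<and>
     (\<forall>i. C_diff m (\<lambda>x. frechet_derivative \<phi> (at x) (axis i 1)))"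

definition grad :: "(real^'n::finite \<Rightarrow> real) \<Rightarrow> real^'n \<Rightarrow> real^'n" where
  "grad \<phi> x = (\<chi> i. frechet_derivative \<phi> (at x) (axis i 1))"

definition test_functions :: "(real^'n::finite) set \<Rightarrow> (real^'n \<Rightarrow> real) set" where
  "test_functions \<Omega> = {\<phi>. (\<forall>m. C_diff m \<phi>) \<and>
     compact (closure {x. \<phi> x \<noteq> 0}) \<and> closure {x. \<phi> x \<noteq> 0} \<subseteq> \<Omega>}"

definition weak_gradient ::
  "(real^'n::finite) set \<Rightarrow> (real^'n \<Rightarrow> real) \<Rightarrow> (real^'n \<Rightarrow> real^'n) \<Rightarrow> bool" where
  "weak_gradient \<Omega> u Du \<longleftrightarrow>
     (\<forall>K. compact K \<longrightarrow> K \<subseteq> \<Omega> \<longrightarrow> integrable (lebesgue_on K) u \<and> integrable (lebesgue_on K) Du) \<and>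
     (\<forall>\<phi>\<in>test_functions \<Omega>. \<forall>i.
        (LINT x|lebesgue_on \<Omega>. u x * grad \<phi> x $ i) = - (LINT x|lebesgue_on \<Omega>. Du x $ i * \<phi> x))"

text \<open>The Sobolev spaces are given as relations between a function and its (a.e. unique) weak
  gradient.\<close>

definition W_1_inf ::
  "(real^'n::finite) set \<Rightarrow> (real^'n \<Rightarrow> real) \<Rightarrow> (real^'n \<Rightarrow> real^'n) \<Rightarrow> bool" where
  "W_1_inf \<Omega> u Du \<longleftrightarrow> weak_gradient \<Omega> u Du \<and>
     u \<in> borel_measurable (lebesgue_on \<Omega>) \<and> Du \<in> borel_measurable (lebesgue_on \<Omega>) \<and>
     (\<exists>C. AE x in lebesgue_on \<Omega>. \<bar>u x\<bar> \<le> C \<and> norm (Du x) \<le> C)"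

text \<open>The closure of the test functions in the norm of \<open>W\<^sup>1\<^sup>,\<^sup>1\<close>.\<close>

definition W0_1_1 ::
  "(real^'n::finite) set \<Rightarrow> (real^'n \<Rightarrow> real) \<Rightarrow> (real^'n \<Rightarrow> real^'n) \<Rightarrow> bool" where
  "W0_1_1 \<Omega> u Du \<longleftrightarrow> weak_gradient \<Omega> u Du \<and>
     integrable (lebesgue_on \<Omega>) u \<and> integrable (lebesgue_on \<Omega>) Du \<and>
     (\<exists>\<phi>. (\<forall>j::nat. \<phi> j \<in> test_functions \<Omega>) \<and>
        (\<lambda>j. (LINT x|lebesgue_on \<Omega>. \<bar>u x - \<phi> j x\<bar>) +
             (LINT x|lebesgue_on \<Omega>. norm (Du x - grad (\<phi> j) x))) \<longlonglongrightarrow> 0)"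

text \<open>The usual convention \<open>W\<^sub>0\<^sup>1\<^sup>,\<^sup>\<infinity> = W\<^sup>1\<^sup>,\<^sup>\<infinity> \<inter> W\<^sub>0\<^sup>1\<^sup>,\<^sup>1\<close> of the calculus of
  variations, not the norm closure of the test functions in \<open>W\<^sup>1\<^sup>,\<^sup>\<infinity>\<close>.\<close>

definition W0_1_inf ::
  "(real^'n::finite) set \<Rightarrow> (real^'n \<Rightarrow> real) \<Rightarrow> (real^'n \<Rightarrow> real^'n) \<Rightarrow> bool" where
  "W0_1_inf \<Omega> u Du \<longleftrightarrow> W_1_inf \<Omega> u Du \<and> W0_1_1 \<Omega> u Du"

definition W0_1_inf_vec ::
  "(real^'n::finite) set \<Rightarrow> (real^'n \<Rightarrow> real^'N::finite) \<Rightarrow> (real^'n \<Rightarrow> real^'n^'N) \<Rightarrow> bool" where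
  "W0_1_inf_vec \<Omega> u Du \<longleftrightarrow> (\<forall>r. W0_1_inf \<Omega> (\<lambda>x. u x $ r) (\<lambda>x. Du x $ r))"

text \<open>The coefficient \<open>\<omega>\<^sub>I\<close> in \<open>\<omega> = \<Sum>\<^sub>I \<omega>\<^sub>I e\<^sup>I\<close> is the value of \<open>\<omega>\<close> on the standard
  basis vectors numbered by \<open>I\<close>; \<open>Dw I\<close> is its weak gradient.\<close>

definition coeff_form :: "'n::finite form \<Rightarrow> 'n list \<Rightarrow> real" where
  "coeff_form \<xi> I = \<xi> (map (\<lambda>i. axis i 1) I)"

definition W0_1_inf_form ::
  "nat \<Rightarrow> (real^'n::{finite,linorder}) set \<Rightarrow> (real^'n::{finite,linorder} \<Rightarrow> 'n form) \<Rightarrow>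
   ('n list \<Rightarrow> real^'n::{finite,linorder} \<Rightarrow> real^'n::{finite,linorder}) \<Rightarrow> bool" where
  "W0_1_inf_form p \<Omega> \<omega> Dw \<longleftrightarrow> (\<forall>x\<in>\<Omega>. \<omega> x \<in> alt_forms p) \<and>
     (\<forall>I\<in>multi_indices p. W0_1_inf \<Omega> (\<lambda>x. coeff_form (\<omega> x) I) (Dw I))"

text \<open>\<open>d\<omega> = \<Sum>\<^sub>I \<Sum>\<^sub>i \<partial>\<^sub>i\<omega>\<^sub>I e\<^sup>i \<and> e\<^sup>I\<close>, in terms of the weak gradients of the coefficients.\<close>

definition ext_deriv ::
  "nat \<Rightarrow> ('n::{finite,linorder} list \<Rightarrow> real^'n::{finite,linorder} \<Rightarrow> real^'n::{finite,linorder}) \<Rightarrow> real^'n::{finite,linorder} \<Rightarrow> 'n form" where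
  "ext_deriv p Dw x =
     (\<Sum>I\<in>multi_indices p. \<Sum>i\<in>UNIV. (Dw I x $ i) *\<^sub>R (dual_basis i \<and>\<^sub>w basis_form I))"

section \<open>Notions of convexity\<close>

definition locally_bounded_on :: "'a::topological_space set \<Rightarrow> ('a \<Rightarrow> real) \<Rightarrow> bool" where
  "locally_bounded_on S f \<longleftrightarrow> (\<forall>x\<in>S. \<exists>U. open U \<and> x \<in> U \<and> bounded (f ` (U \<inter> S)))"

text \<open>The product \<open>V 1 \<times> \<dots> \<times> V m\<close>, as families extended by \<open>0\<close> to the other indices.\<close>

definition family_product :: "nat \<Rightarrow> (nat \<Rightarrow> 'a::zero set) \<Rightarrow> (nat \<Rightarrow> 'a) set" where
  "family_product m V = {X. \<forall>s. if s \<in> {1..m} then X s \<in> V s else X s = 0}"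

definition family :: "nat \<Rightarrow> (nat \<Rightarrow> 'a::zero) \<Rightarrow> nat \<Rightarrow> 'a" where
  "family m X s = (if s \<in> {1..m} then X s else 0)"

text \<open>A function on \<open>\<Lambda>\<^sup>k\<close> is represented by a total function on \<open>'n form\<close> of which only the
  values on \<open>alt_forms k\<close> are used.\<close>

definition ext_one_convex :: "nat \<Rightarrow> ('n::finite form \<Rightarrow> real) \<Rightarrow> bool" where
  "ext_one_convex k f \<longleftrightarrow>
     (\<forall>\<xi>\<in>alt_forms k. \<forall>\<alpha>\<in>alt_forms (k - 1). \<forall>\<beta>\<in>alt_forms 1.
        convex_on UNIV (\<lambda>t::real. f (\<xi> + t *\<^sub>R (\<alpha> \<and>\<^sub>w \<beta>))))"

definition ext_quasiconvex :: "nat \<Rightarrow> ('n::{finite,linorder} form \<Rightarrow> real) \<Rightarrow> bool" where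
  "ext_quasiconvex k f \<longleftrightarrow>
     f \<in> borel_measurable (restrict_space borel (alt_forms k)) \<and>
     locally_bounded_on (alt_forms k) f \<and>
     (\<forall>\<Omega> \<xi> \<omega> Dw. bounded \<Omega> \<longrightarrow> open \<Omega> \<longrightarrow> \<xi> \<in> alt_forms k \<longrightarrow>
        W0_1_inf_form (k - 1) \<Omega> \<omega> Dw \<longrightarrow>
        (LINT x|lebesgue_on \<Omega>. f (\<xi> + ext_deriv (k - 1) Dw x)) \<ge> f \<xi> * measure lebesgue \<Omega>)"

definition ext_polyconvex :: "nat \<Rightarrow> ('n::finite form \<Rightarrow> real) \<Rightarrow> bool" where
  "ext_polyconvex k f \<longleftrightarrow>
     (\<exists>F. convex_on (family_product (CARD('n) div k) (\<lambda>s. alt_forms (s * k))) F \<and>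
        (\<forall>\<xi>\<in>alt_forms k. f \<xi> = F (family (CARD('n) div k) (wedge_power \<xi>))))"

definition rank_one_convex :: "(real^'n::finite^'N::finite \<Rightarrow> real) \<Rightarrow> bool" where
  "rank_one_convex \<phi> \<longleftrightarrow>
     (\<forall>X. \<forall>a::real^'N. \<forall>b::real^'n.
        convex_on UNIV (\<lambda>t::real. \<phi> (X + t *\<^sub>R (\<chi> r i. a $ r * b $ i))))"

definition quasiconvex :: "(real^'n::finite^'N::finite \<Rightarrow> real) \<Rightarrow> bool" where
  "quasiconvex \<phi> \<longleftrightarrow>
     \<phi> \<in> borel_measurable borel \<and> locally_bounded_on UNIV \<phi> \<and>
     (\<forall>\<Omega> X u Du. bounded \<Omega> \<longrightarrow> open \<Omega> \<longrightarrow> W0_1_inf_vec \<Omega> u Du \<longrightarrow>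
        (LINT x|lebesgue_on \<Omega>. \<phi> (X + Du x)) \<ge> \<phi> X * measure lebesgue \<Omega>)"

text \<open>The \<open>s \<times> s\<close> minors (by the Leibniz formula) with rows \<open>I\<close> and columns \<open>J\<close>; an element of
  the space of \<open>(N choose s) \<times> (n choose s)\<close> matrices is a function of \<open>I\<close> and \<open>J\<close> vanishing off
  the multiindices of length \<open>s\<close>.\<close>

definition adj ::
  "real^'n::{finite,linorder}^'N::{finite,linorder} \<Rightarrow> nat \<Rightarrow> 'N list \<Rightarrow> 'n list \<Rightarrow> real" where
  "adj X s I J = (if I \<in> multi_indices s \<and> J \<in> multi_indices s
     then \<Sum>p | p permutes {..<s}. of_int (sign p) * (\<Prod>a<s. X $ (I ! a) $ (J ! p a)) else 0)"

definition minor_space ::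
  "nat \<Rightarrow> ('N::{finite,linorder} list \<Rightarrow> 'n::{finite,linorder} list \<Rightarrow> real) set" where
  "minor_space s = {A. \<forall>I J. \<not> (I \<in> multi_indices s \<and> J \<in> multi_indices s) \<longrightarrow> A I J = 0}"

definition polyconvex ::
  "(real^'n::{finite,linorder}^'N::{finite,linorder} \<Rightarrow> real) \<Rightarrow> bool" where
  "polyconvex \<phi> \<longleftrightarrow>
     (\<exists>G. convex_on (family_product (min CARD('N) CARD('n))
              (minor_space :: nat \<Rightarrow> ('N list \<Rightarrow> 'n list \<Rightarrow> real) set)) G \<and>
        (\<forall>X. \<phi> X = G (family (min CARD('N) CARD('n)) (adj X))))"

end

theory Submission
  imports Defs
begin

text \<open>Write \<open>X\<^sub>r\<close> for the rows of a matrix \<open>X\<close>, read as 1-forms, and \<open>I\<^sub>r\<close> for the multiindex of the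
  row \<open>r\<close>. Then \<open>\<pi> X\<close> is the sum of the products \<open>e\<^bsup>I\<^sub>r\<^esup> \<and> X\<^sub>r\<close>. So \<open>\<pi>\<close> is linear, it sends \<open>a \<otimes> b\<close> to
  \<open>\<alpha> \<and> b\<close> where \<open>\<alpha>\<close> is the \<open>(k - 1)\<close>-form with coefficients \<open>a\<close>, and it has the linear section
  \<open>lift\<close>. Since every \<open>(k - 1)\<close>-form and every 1-form occur here, the lines in the definitions of the
  two rank-one notions correspond to each other. In the same way \<open>d\<omega> = (-1)\<^bsup>k-1\<^esup> \<pi> (\<nabla>u)\<close> when \<open>u\<close>
  lists the coefficients of \<open>\<omega>\<close>, and a constant sign can be absorbed into \<open>u\<close>. These two
  equivalences are \<open>ext_one_convex_iff_rank_one_convex\<close> and \<open>ext_quasiconvex_iff_quasiconvex\<close>.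

  For polyconvexity one direction is an expansion. The power \<open>(\<pi> X)\<^sup>s\<close> is the sum over all
  \<open>s\<close>-tuples of rows of \<open>(e\<^bsup>I\<^sub>1\<^esup> \<and> X\<^sub>1) \<and> \<dots> \<and> (e\<^bsup>I\<^sub>s\<^esup> \<and> X\<^sub>s)\<close>, and each summand is alternating in the
  rows that enter it. An alternating function of \<open>s\<close> rows is a linear combination of their
  \<open>s \<times> s\<close> minors, so \<open>(\<pi> X)\<^sup>s\<close> is a linear function of \<open>adj X s\<close> (\<open>wedge_power_proj\<close>), and a convex
  function composed with a linear map is convex.

  For the converse let \<open>f (\<pi> X) = G (X, adj\<^sub>2 X, \<dots>)\<close> with \<open>G\<close> convex. It suffices to find a linear
  map \<open>\<Psi>\<close> with \<open>G (\<Psi> (\<xi>, \<xi>\<^sup>2, \<dots>)) = f \<xi>\<close>, because then \<open>F = G \<circ> \<Psi>\<close>. If \<open>\<pi> (a \<otimes> b) = 0\<close>, the minors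
  of \<open>Y + t a \<otimes> b\<close> are affine in \<open>t\<close> while \<open>f (\<pi> (Y + t a \<otimes> b))\<close> does not depend on \<open>t\<close>; so \<open>G\<close> is
  constant on a line. A finite convex function that is constant on one line is constant on all
  parallel lines (\<open>invariant_direction_if_constant_on_line\<close>). Hence the subspace \<open>U\<close> of all
  directions in which \<open>G\<close> is invariant contains the differences \<open>adj (Y + a \<otimes> b) - adj Y\<close> and, as
  one sees by scaling \<open>Y\<close>, their components of each order \<open>s\<close>.

  Modulo \<open>U\<close> the minors of order \<open>s\<close> of \<open>\<alpha>\<^sub>1 \<otimes> b\<^sub>1 + \<dots> + \<alpha>\<^sub>s \<otimes> b\<^sub>s\<close>, where each \<open>\<alpha>\<^sub>j\<close> is a product of \<open>k - 1\<close>
  1-forms, are alternating in all \<open>s k\<close> factors of \<open>\<alpha>\<^sub>1, b\<^sub>1, \<dots>, \<alpha>\<^sub>s, b\<^sub>s\<close> (\<open>block_form_alt\<close>). An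
  alternating function of vectors, read as 1-forms, is a linear function of their wedge product, and expanding
  \<open>\<xi>\<close> in basis forms therefore shows that \<open>adj (lift \<xi>) s\<close> agrees modulo \<open>U\<close> with a linear function
  of \<open>\<xi>\<^sup>s\<close> (\<open>kernel_blind_adj_lift\<close>).\<close>

section \<open>The exterior algebra on functions of lists\<close>

lemma scaleR_fun_apply [simp]: "(c *\<^sub>R f) x = c *\<^sub>R f x"
  by (simp add: scaleR_fun_def)

text \<open>The wedge product is defined for all functions on lists of vectors. On these, \<open>iota v\<close> (the interior
  product with \<open>v\<close>) and the grading involution \<open>parity\<close> turn identities between wedge products into
  inductions on the argument list.\<close>

definition iota :: "real^'n \<Rightarrow> 'n::finite form \<Rightarrow> 'n form" where
  "iota v \<alpha> = (\<lambda>vs. \<alpha> (v # vs))"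

definition parity :: "'n::finite form \<Rightarrow> 'n form" where
  "parity \<alpha> = (\<lambda>vs. (-1) ^ length vs * \<alpha> vs)"

lemma iota_linear [simp]:
  "iota v (\<alpha> + \<beta>) = iota v \<alpha> + iota v \<beta>" "iota v (c *\<^sub>R \<alpha>) = c *\<^sub>R iota v \<alpha>"
  "iota v (- \<alpha>) = - iota v \<alpha>" "iota v 0 = 0"
  by (auto simp: iota_def scaleR_fun_def fun_eq_iff)

lemma parity_linear [simp]:
  "parity (\<alpha> + \<beta>) = parity \<alpha> + parity \<beta>" "parity (c *\<^sub>R \<alpha>) = c *\<^sub>R parity \<alpha>"
  "parity (- \<alpha>) = - parity \<alpha>" "parity 0 = 0"
  by (auto simp: parity_def scaleR_fun_def fun_eq_iff algebra_simps)

lemma parity_parity [simp]: "parity (parity \<alpha>) = \<alpha>"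
  by (auto simp: parity_def fun_eq_iff simp flip: power_add mult.assoc)

lemma iota_parity [simp]: "iota v (parity \<alpha>) = - parity (iota v \<alpha>)"
  by (auto simp: parity_def iota_def fun_eq_iff)

lemma wedge_add_left: "(\<alpha> + \<beta>) \<and>\<^sub>w \<gamma> = \<alpha> \<and>\<^sub>w \<gamma> + \<beta> \<and>\<^sub>w \<gamma>"
  by (auto simp: wedge_def fun_eq_iff algebra_simps sum.distrib)

lemma wedge_add_right: "\<gamma> \<and>\<^sub>w (\<alpha> + \<beta>) = \<gamma> \<and>\<^sub>w \<alpha> + \<gamma> \<and>\<^sub>w \<beta>"
  by (auto simp: wedge_def fun_eq_iff algebra_simps sum.distrib)

lemma wedge_scale_left: "(c *\<^sub>R \<alpha>) \<and>\<^sub>w \<beta> = c *\<^sub>R (\<alpha> \<and>\<^sub>w \<beta>)"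
  by (auto simp: wedge_def scaleR_fun_def fun_eq_iff sum_distrib_left algebra_simps)

lemma wedge_scale_right: "\<alpha> \<and>\<^sub>w (c *\<^sub>R \<beta>) = c *\<^sub>R (\<alpha> \<and>\<^sub>w \<beta>)"
  by (auto simp: wedge_def scaleR_fun_def fun_eq_iff sum_distrib_left algebra_simps)

lemma linear_wedge_left: "linear (\<lambda>\<alpha>. \<alpha> \<and>\<^sub>w \<beta>)"
  by (rule linearI) (auto simp: wedge_add_left wedge_scale_left)

lemma linear_wedge_right: "linear (\<lambda>\<beta>. \<alpha> \<and>\<^sub>w \<beta>)"
  by (rule linearI) (auto simp: wedge_add_right wedge_scale_right)

lemmas wedge_simps [simp] =
  linear_0 [OF linear_wedge_left] linear_0 [OF linear_wedge_right]
  linear_neg [OF linear_wedge_left] linear_neg [OF linear_wedge_right]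

text \<open>The two cases say what an additional first argument does to the sign of a shuffle. If it goes to
  the right factor, all arguments of the left factor have to pass it; if it goes to the left factor,
  nothing passes it.\<close>

lemma shuffle_sign_Suc_image:
  assumes "finite S"
  shows "shuffle_sign (Suc ` S) = (-1) ^ card S * shuffle_sign S"
    and "shuffle_sign (insert 0 (Suc ` S)) = shuffle_sign S"
proof -
  let ?R = "{(i, j). i \<in> S \<and> j \<notin> S \<and> j < i}"
  have fin: "finite ?R"
    by (rule finite_subset[of _ "Sigma S (\<lambda>i. {..<i})"]) (use assms in auto)
  have inj: "inj_on (map_prod Suc Suc) ?R" by (auto simp: inj_on_def)
  have 0: "{(i, j). i \<in> insert 0 (Suc ` S) \<and> j \<notin> insert 0 (Suc ` S) \<and> j < i} = map_prod Suc Suc ` ?R"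
    (is "?A = _")
  proof (intro equalityI subsetI)
    fix x assume "x \<in> ?A"
    then obtain i j where x: "x = (Suc i, Suc j)" "i \<in> S" "j \<notin> S" "j < i"
      by (cases x; cases "snd x") (auto simp: image_iff)
    then show "x \<in> map_prod Suc Suc ` ?R" by force
  qed auto
  have 1: "{(i, j). i \<in> Suc ` S \<and> j \<notin> Suc ` S \<and> j < i} = (Suc ` S) \<times> {0} \<union> map_prod Suc Suc ` ?R"
    (is "?B = _")
  proof (intro equalityI subsetI)
    fix x assume "x \<in> ?B"
    then obtain i j where "x = (Suc i, j)" "i \<in> S" "j \<notin> Suc ` S" "j < Suc i"
      by (cases x) auto
    then show "x \<in> (Suc ` S) \<times> {0} \<union> map_prod Suc Suc ` ?R" by (cases j) force+
  qed auto
  have "card ?B = card S + card ?R" unfolding 1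
    by (subst card_Un_disjoint) (use assms fin in \<open>auto simp: card_image inj\<close>)
  then show "shuffle_sign (Suc ` S) = (-1) ^ card S * shuffle_sign S"
    by (simp add: shuffle_sign_def power_add)
  show "shuffle_sign (insert 0 (Suc ` S)) = shuffle_sign S"
    unfolding shuffle_sign_def 0 by (simp add: card_image inj)
qed

lemma Pow_lessThan_Suc:
  "Pow {..<Suc n} = (\<lambda>S. insert 0 (Suc ` S)) ` Pow {..<n} \<union> (\<lambda>S. Suc ` S) ` Pow {..<n}"
  unfolding lessThan_Suc_eq_insert_0 Pow_insert image_Pow_surj[OF refl, symmetric] image_image
  by (auto simp: image_Un image_image)

text \<open>The interior product is an antiderivation: split the sum over shuffles according to the factor
  that receives the first argument.\<close>

lemma iota_wedge: "iota v (\<alpha> \<and>\<^sub>w \<beta>) = iota v \<alpha> \<and>\<^sub>w \<beta> + parity \<alpha> \<and>\<^sub>w iota v \<beta>"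
proof
  fix vs :: "(real^'a) list"
  let ?n = "length vs"
  let ?g = "\<lambda>S. shuffle_sign S * \<alpha> (nths (v # vs) S) * \<beta> (nths (v # vs) (- S))"
  have inj: "inj_on (\<lambda>S. insert 0 (Suc ` S)) (Pow {..<?n})" "inj_on ((`) Suc) (Pow {..<?n})"
    by (auto simp: inj_on_def inj_image_eq_iff insert_ident)
  have compl: "{j. Suc j \<notin> Suc ` S} = - S" "{j. Suc j \<in> Suc ` S} = S" for S by auto
  have "(\<alpha> \<and>\<^sub>w \<beta>) (v # vs) = sum ?g (Pow {..<Suc ?n})"
    by (simp add: wedge_def)
  also have "\<dots> = (\<Sum>S\<in>Pow {..<?n}. ?g (insert 0 (Suc ` S))) + (\<Sum>S\<in>Pow {..<?n}. ?g (Suc ` S))"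
    unfolding Pow_lessThan_Suc
    by (subst sum.union_disjoint) (auto simp: sum.reindex[OF inj(1)] sum.reindex[OF inj(2)])
  also have "(\<Sum>S\<in>Pow {..<?n}. ?g (insert 0 (Suc ` S))) = (iota v \<alpha> \<and>\<^sub>w \<beta>) vs"
    unfolding wedge_def
    by (intro sum.cong refl)
       (auto simp: shuffle_sign_Suc_image finite_subset[of _ "{..<?n}"] nths_Cons compl iota_def)
  also have "(\<Sum>S\<in>Pow {..<?n}. ?g (Suc ` S)) = (parity \<alpha> \<and>\<^sub>w iota v \<beta>) vs"
    unfolding wedge_def
  proof (intro sum.cong refl)
    fix S assume S: "S \<in> Pow {..<?n}"
    then have "length (nths vs S) = card S"
      unfolding length_nths by (intro arg_cong[where f = card]) auto
    with S show "?g (Suc ` S) = shuffle_sign S * parity \<alpha> (nths vs S) * iota v \<beta> (nths vs (- S))"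
      by (auto simp: shuffle_sign_Suc_image finite_subset[of _ "{..<?n}"] nths_Cons compl iota_def parity_def)
  qed
  finally show "iota v (\<alpha> \<and>\<^sub>w \<beta>) vs = (iota v \<alpha> \<and>\<^sub>w \<beta> + parity \<alpha> \<and>\<^sub>w iota v \<beta>) vs"
    by (simp add: iota_def)
qed

lemma wedge_Nil [simp]: "(\<alpha> \<and>\<^sub>w \<beta>) [] = \<alpha> [] * \<beta> []"
  by (simp add: wedge_def shuffle_sign_def)

lemma wedge_Cons: "(\<alpha> \<and>\<^sub>w \<beta>) (v # vs) = (iota v \<alpha> \<and>\<^sub>w \<beta>) vs + (parity \<alpha> \<and>\<^sub>w iota v \<beta>) vs"
  using fun_cong[OF iota_wedge[of v \<alpha> \<beta>], of vs] by (simp add: iota_def)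

lemma parity_wedge: "parity (\<alpha> \<and>\<^sub>w \<beta>) = parity \<alpha> \<and>\<^sub>w parity \<beta>"
proof
  show "parity (\<alpha> \<and>\<^sub>w \<beta>) vs = (parity \<alpha> \<and>\<^sub>w parity \<beta>) vs" for vs
  proof (induction vs arbitrary: \<alpha> \<beta>)
    case (Cons v vs)
    have "parity (\<alpha> \<and>\<^sub>w \<beta>) (v # vs) = iota v (parity (\<alpha> \<and>\<^sub>w \<beta>)) vs" by (simp add: iota_def)
    also have "\<dots> = - (parity (iota v \<alpha> \<and>\<^sub>w \<beta>) vs + parity (parity \<alpha> \<and>\<^sub>w iota v \<beta>) vs)"
      by (simp add: iota_wedge)
    finally show ?case by (simp add: Cons.IH wedge_Cons)
  qed (simp add: parity_def)
qed

lemma wedge_assoc: "(\<alpha> \<and>\<^sub>w \<beta>) \<and>\<^sub>w \<gamma> = \<alpha> \<and>\<^sub>w \<beta> \<and>\<^sub>w \<gamma>"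
proof
  show "((\<alpha> \<and>\<^sub>w \<beta>) \<and>\<^sub>w \<gamma>) vs = (\<alpha> \<and>\<^sub>w \<beta> \<and>\<^sub>w \<gamma>) vs" for vs
    by (induction vs arbitrary: \<alpha> \<beta> \<gamma>)
       (simp_all add: wedge_Cons iota_wedge parity_wedge wedge_add_left wedge_add_right)
qed

lemma iota_unit [simp]: "iota v unit_form = 0"
  by (auto simp: iota_def unit_form_def fun_eq_iff)

lemma parity_unit [simp]: "parity unit_form = unit_form"
  by (auto simp: parity_def unit_form_def fun_eq_iff)

lemma unit_wedge [simp]: "unit_form \<and>\<^sub>w \<alpha> = \<alpha>"
proof
  show "(unit_form \<and>\<^sub>w \<alpha>) vs = \<alpha> vs" for vs
    by (induction vs arbitrary: \<alpha>) (simp_all add: wedge_Cons, simp_all add: unit_form_def iota_def)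
qed

lemma wedge_unit [simp]: "\<alpha> \<and>\<^sub>w unit_form = \<alpha>"
proof
  show "(\<alpha> \<and>\<^sub>w unit_form) vs = \<alpha> vs" for vs
    by (induction vs arbitrary: \<alpha>) (simp_all add: wedge_Cons, simp_all add: unit_form_def iota_def)
qed

definition flat :: "real^'n \<Rightarrow> 'n::finite form" where
  "flat w vs = (case vs of [v] \<Rightarrow> w \<bullet> v | _ \<Rightarrow> 0)"

lemma flat_axis: "flat (axis i 1) = dual_basis i"
proof
  show "flat (axis i 1) vs = dual_basis i vs" for vs
    by (cases vs rule: remdups_adj.cases) (auto simp: flat_def dual_basis_def inner_axis')
qed

lemma iota_flat [simp]: "iota v (flat w) = (w \<bullet> v) *\<^sub>R unit_form"
  by (auto simp: iota_def flat_def unit_form_def scaleR_fun_def fun_eq_iff split: list.splits)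

lemma flat_Nil [simp]: "flat w [] = 0"
  by (simp add: flat_def)

lemma parity_flat [simp]: "parity (flat w) = - flat w"
  by (auto simp: parity_def flat_def fun_eq_iff split: list.splits)

lemma linear_flat: "linear flat"
  by (rule linearI) (auto simp: flat_def scaleR_fun_def fun_eq_iff inner_add_left split: list.splits)

text \<open>Graded commutativity, for moving a 1-form past the other factors of a product.\<close>

lemma flat_wedge_commute: "flat w \<and>\<^sub>w \<beta> = parity \<beta> \<and>\<^sub>w flat w"
proof
  show "(flat w \<and>\<^sub>w \<beta>) vs = (parity \<beta> \<and>\<^sub>w flat w) vs" for vs
    by (induction vs arbitrary: \<beta>) (simp_all add: wedge_Cons wedge_scale_left wedge_scale_right)
qed

lemma flat_wedge_self [simp]: "flat w \<and>\<^sub>w flat w = 0"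
proof -
  have "flat w \<and>\<^sub>w flat w = - (flat w \<and>\<^sub>w flat w)"
    using flat_wedge_commute[of w "flat w"] by simp
  then show ?thesis by (auto simp: fun_eq_iff)
qed

lemma flat_wedge_twice [simp]: "flat w \<and>\<^sub>w flat w \<and>\<^sub>w \<beta> = 0"
  by (simp flip: wedge_assoc)

section \<open>Alternating forms\<close>

lemma linear_fun_eval: "linear (\<lambda>\<xi>. (\<xi> x :: real))"
  by (rule linearI) (auto simp: scaleR_fun_def)

lemma sum_fun_apply: "(\<Sum>i\<in>A. f i) x = (\<Sum>i\<in>A. f i x)" for f :: "_ \<Rightarrow> _ \<Rightarrow> 'b::comm_monoid_add"
  by (induction A rule: infinite_finite_induct) auto

lemma subspace_alt_forms: "subspace (alt_forms k)"
proof (rule subspaceI)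
  show "0 \<in> alt_forms k" by (auto simp: alt_forms_def module_hom_zero linear_iff)
  show "x + y \<in> alt_forms k" if "x \<in> alt_forms k" "y \<in> alt_forms k" for x y :: "'a form"
    using that by (auto simp: alt_forms_def intro!: linear_compose_add)
  show "c *\<^sub>R x \<in> alt_forms k" if "x \<in> alt_forms k" for c and x :: "'a form"
    using that by (auto simp: alt_forms_def scaleR_fun_def linear_iff algebra_simps)
qed

lemmas alt_forms_add = subspace_add [OF subspace_alt_forms]
  and alt_forms_scale = subspace_scale [OF subspace_alt_forms]
  and alt_forms_sum = subspace_sum [OF subspace_alt_forms]
  and alt_forms_0 [simp] = subspace_0 [OF subspace_alt_forms]
  and alt_forms_diff = subspace_diff [OF subspace_alt_forms]

lemma alt_forms_length: "\<xi> \<in> alt_forms k \<Longrightarrow> length vs \<noteq> k \<Longrightarrow> \<xi> vs = 0"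
  by (simp add: alt_forms_def)

lemma alternating_swap:
  assumes "\<And>us. linear (\<lambda>v. \<xi> (v # us))" "\<And>v us. linear (\<lambda>w. \<xi> (v # w # us))"
    and "\<And>v us. \<xi> (v # v # us) = (0::real)"
  shows "\<xi> (v # w # us) = - \<xi> (w # v # us)"
proof -
  have "0 = \<xi> ((v + w) # (v + w) # us)" using assms(3) by simp
  also have "\<dots> = \<xi> (v # v # us) + \<xi> (w # v # us) + \<xi> (v # w # us) + \<xi> (w # w # us)"
    by (simp add: linear_add[OF assms(1)] linear_add[OF assms(2)])
  finally show ?thesis using assms(3) by simp
qed

text \<open>This recursive description of \<open>alt_forms\<close> carries the inductions on the degree. The condition on
  the first two arguments suffices: equal arguments at positions \<open>0\<close> and \<open>j > 1\<close> are reduced to it by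
  swapping the first two arguments.\<close>

lemma alt_forms_Suc:
  fixes \<xi> :: "'n::finite form"
  shows "\<xi> \<in> alt_forms (Suc k) \<longleftrightarrow> \<xi> [] = 0 \<and> (\<forall>v. iota v \<xi> \<in> alt_forms k) \<and>
    (\<forall>vs. linear (\<lambda>v. \<xi> (v # vs))) \<and> (\<forall>v vs. \<xi> (v # v # vs) = 0)" (is "?L \<longleftrightarrow> ?R")
proof
  assume L: ?L
  then have len: "\<And>vs. length vs \<noteq> Suc k \<Longrightarrow> \<xi> vs = 0"
    and lin: "\<And>vs i. length vs = Suc k \<Longrightarrow> i < Suc k \<Longrightarrow> linear (\<lambda>x. \<xi> (vs[i := x]))"
    and alt: "\<And>vs i j. length vs = Suc k \<Longrightarrow> i < j \<Longrightarrow> j < Suc k \<Longrightarrow> vs ! i = vs ! j \<Longrightarrow> \<xi> vs = 0"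
    by (auto simp: alt_forms_def)
  have "iota v \<xi> \<in> alt_forms k" for v
    unfolding alt_forms_def iota_def
  proof (clarsimp, intro conjI allI impI)
    show "\<xi> (v # vs) = 0" if "length vs \<noteq> k" for vs using len that by simp
    show "linear (\<lambda>x. \<xi> (v # vs[i := x]))" if "length vs = k" "i < k" for vs i
      using lin[of "v # vs" "Suc i"] that by simp
    show "\<xi> (v # vs) = 0" if "length vs = k" "i < j" "j < k" "vs ! i = vs ! j" for vs i j
      using alt[of "v # vs" "Suc i" "Suc j"] that by simp
  qed
  moreover have "linear (\<lambda>v. \<xi> (v # vs))" for vs
  proof (cases "length vs = k")
    case True then show ?thesis using lin[of "0 # vs" 0] by simp
  qed (use len linear_zero in simp)
  moreover have "\<xi> (v # v # vs) = 0" for v vs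
    using alt[of "v # v # vs" 0 1] len[of "v # v # vs"] by fastforce
  ultimately show ?R using len by simp
next
  assume R: ?R
  then have 0: "\<xi> [] = 0" and io: "\<And>v. iota v \<xi> \<in> alt_forms k"
    and lin: "\<And>vs. linear (\<lambda>v. \<xi> (v # vs))" and alt: "\<And>v vs. \<xi> (v # v # vs) = 0" by auto
  have io1: "\<And>v vs. length vs \<noteq> k \<Longrightarrow> \<xi> (v # vs) = 0"
    and io2: "\<And>v vs i. length vs = k \<Longrightarrow> i < k \<Longrightarrow> linear (\<lambda>x. \<xi> (v # vs[i := x]))"
    and io3: "\<And>v vs i j. length vs = k \<Longrightarrow> i < j \<Longrightarrow> j < k \<Longrightarrow> vs ! i = vs ! j \<Longrightarrow> \<xi> (v # vs) = 0"
    using io by (auto simp: alt_forms_def iota_def)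
  show ?L unfolding alt_forms_def
  proof (clarsimp, intro conjI allI impI)
    show "\<xi> vs = 0" if "length vs \<noteq> Suc k" for vs
      using that 0 io1 by (cases vs) auto
    show "linear (\<lambda>x. \<xi> (vs[i := x]))" if "length vs = Suc k" "i < Suc k" for vs i
      using that lin io2 by (cases vs; cases i) auto
    show "\<xi> vs = 0" if vs: "length vs = Suc k" "i < j" "j < Suc k" "vs ! i = vs ! j" for vs i j
    proof (cases i)
      case (Suc i')
      then show ?thesis using vs io3 by (cases vs; cases j) auto
    next
      case 0
      then obtain v w us j' where [simp]: "vs = v # w # us" "j = Suc j'"
        using vs by (cases vs; cases "tl vs"; cases j) auto
      show ?thesis
      proof (cases j')
        case 0 then show ?thesis using vs alt \<open>i = 0\<close> by simp
      next
        case (Suc m)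
        have lin2: "linear (\<lambda>w. \<xi> (v # w # us))" for v us
        proof (cases "length (0 # us :: (real^'n) list) = k")
          case True then show ?thesis using io2[of "0 # us" 0] by (simp only: list_update.simps nat.case) auto
        next
          case False then show ?thesis using io1 linear_zero by (simp add: fun_eq_iff)
        qed
        have "\<xi> vs = - \<xi> (w # v # us)"
          unfolding \<open>vs = _\<close> by (rule alternating_swap [of \<xi>, OF lin lin2 alt])
        also have "\<xi> (w # v # us) = 0"
          using vs \<open>i = 0\<close> Suc by (intro io3[of _ 0 j']) auto
        finally show ?thesis by simp
      qed
    qed
  qed
qed

lemma alt_forms_zero: "\<xi> \<in> alt_forms 0 \<longleftrightarrow> (\<exists>c. \<xi> = c *\<^sub>R unit_form)"
proof
  assume "\<xi> \<in> alt_forms 0"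
  then have "\<xi> = \<xi> [] *\<^sub>R unit_form"
    by (auto simp: alt_forms_def unit_form_def scaleR_fun_def fun_eq_iff)
  then show "\<exists>c. \<xi> = c *\<^sub>R unit_form" ..
qed (auto simp: alt_forms_def unit_form_def scaleR_fun_def)

lemma unit_alt [simp]: "unit_form \<in> alt_forms 0"
  by (auto simp: alt_forms_def unit_form_def)

lemma iota_alt: "\<xi> \<in> alt_forms (Suc k) \<Longrightarrow> iota v \<xi> \<in> alt_forms k"
  by (simp add: alt_forms_Suc)

lemma iota_alt_zero: "\<xi> \<in> alt_forms 0 \<Longrightarrow> iota v \<xi> = 0"
  by (auto simp: alt_forms_zero)

lemma iota_alt_pred: "\<xi> \<in> alt_forms k \<Longrightarrow> iota v \<xi> \<in> alt_forms (k - 1)"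
  by (cases k) (auto simp: iota_alt iota_alt_zero)

lemma linear_Cons: "\<xi> \<in> alt_forms k \<Longrightarrow> linear (\<lambda>v. \<xi> (v # vs))"
proof (cases k)
  case 0
  then show "\<xi> \<in> alt_forms k \<Longrightarrow> linear (\<lambda>v. \<xi> (v # vs))" using linear_zero by (simp add: alt_forms_length)
qed (simp add: alt_forms_Suc)

lemma linear_iota: "\<xi> \<in> alt_forms k \<Longrightarrow> linear (\<lambda>v. iota v \<xi>)"
  using linear_Cons by (fastforce simp: linear_iff iota_def fun_eq_iff scaleR_fun_def)

lemma iota_iota_self: "\<xi> \<in> alt_forms k \<Longrightarrow> iota v (iota v \<xi>) = 0"
proof (cases k)
  case 0
  then show "\<xi> \<in> alt_forms k \<Longrightarrow> iota v (iota v \<xi>) = 0" by (simp add: iota_alt_zero)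
qed (auto simp: alt_forms_Suc iota_def fun_eq_iff)

lemma iota_anticommute:
  assumes "\<xi> \<in> alt_forms k"
  shows "iota v (iota w \<xi>) = - iota w (iota v \<xi>)"
proof -
  have "0 = iota (v + w) (iota (v + w) \<xi>)" using iota_iota_self[OF assms] by simp
  also have "\<dots> = iota v (iota w \<xi>) + iota w (iota v \<xi>)"
    using iota_iota_self[OF assms] linear_add[OF linear_iota[OF assms]] linear_add[OF linear_iota[OF iota_alt_pred[OF assms]]]
    by simp
  finally show ?thesis by (metis add_eq_0_iff2)
qed

lemma parity_alt: "\<xi> \<in> alt_forms k \<Longrightarrow> parity \<xi> = (-1) ^ k *\<^sub>R \<xi>"
  by (auto simp: parity_def fun_eq_iff scaleR_fun_def) (metis alt_forms_length mult_zero_right)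

lemma parity_in_alt [simp]: "\<xi> \<in> alt_forms k \<Longrightarrow> parity \<xi> \<in> alt_forms k"
  by (simp add: parity_alt alt_forms_scale)

lemma flat_alt [simp]: "flat w \<in> alt_forms 1"
  unfolding One_nat_def alt_forms_Suc
  by (auto simp: alt_forms_zero) (auto simp: flat_def split: list.splits intro!: linearI simp: inner_right_distrib)

text \<open>Repeated interior multiplication by \<open>v\<close> kills \<open>\<alpha> \<and> \<beta>\<close> because the two mixed terms cancel, the
  involution anticommuting with \<open>iota v\<close>.\<close>

lemma wedge_alt:
  "\<alpha> \<in> alt_forms p \<Longrightarrow> \<beta> \<in> alt_forms q \<Longrightarrow> \<alpha> \<and>\<^sub>w \<beta> \<in> alt_forms (p + q)"
proof (induction "p + q" arbitrary: p q \<alpha> \<beta>)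
  case 0
  then show ?case by (auto simp: alt_forms_zero wedge_scale_left)
next
  case (Suc m)
  note al = Suc.prems(1) and be = Suc.prems(2)
  have 1: "iota v \<alpha> \<and>\<^sub>w \<beta> \<in> alt_forms m" for v
  proof (cases p)
    case 0 then show ?thesis using al by (simp add: iota_alt_zero)
  next
    case (Suc p')
    then show ?thesis using Suc.hyps(1)[of p' q "iota v \<alpha>" \<beta>] Suc.hyps(2) al be by (simp add: iota_alt)
  qed
  have 2: "parity \<alpha> \<and>\<^sub>w iota v \<beta> \<in> alt_forms m" for v
  proof (cases q)
    case 0 then show ?thesis using be by (simp add: iota_alt_zero)
  next
    case (Suc q')
    then show ?thesis using Suc.hyps(1)[of p q' "parity \<alpha>" "iota v \<beta>"] Suc.hyps(2) al be by (simp add: iota_alt)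
  qed
  have "linear (\<lambda>v. iota v (\<alpha> \<and>\<^sub>w \<beta>))"
    unfolding iota_wedge
    by (intro linear_compose_add linear_compose[OF linear_iota linear_wedge_left, unfolded o_def]
         linear_compose[OF linear_iota linear_wedge_right, unfolded o_def]) (rule al be)+
  then have "linear (\<lambda>v. (\<alpha> \<and>\<^sub>w \<beta>) (v # vs))" for vs
    using linear_compose[OF _ linear_fun_eval[of vs]] by (force simp: o_def iota_def)
  moreover have "iota v (iota v (\<alpha> \<and>\<^sub>w \<beta>)) = 0" for v
    using iota_iota_self[OF al] iota_iota_self[OF be] by (simp add: iota_wedge)
  then have "(\<alpha> \<and>\<^sub>w \<beta>) (v # v # vs) = 0" for v vs
    by (metis iota_def zero_fun_apply)
  moreover have "(\<alpha> \<and>\<^sub>w \<beta>) [] = 0"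
    using al be Suc.hyps(2) by (cases p; cases q) (auto simp: alt_forms_length)
  moreover have "iota v (\<alpha> \<and>\<^sub>w \<beta>) \<in> alt_forms m" for v
    unfolding iota_wedge using 1 2 by (rule alt_forms_add)
  ultimately show ?case unfolding Suc.hyps(2)[symmetric] alt_forms_Suc by blast
qed

definition flats :: "(real^'n) list \<Rightarrow> 'n::finite form" where
  "flats ws = foldr (\<lambda>w. (\<and>\<^sub>w) (flat w)) ws unit_form"

lemma flats_simps [simp]: "flats [] = unit_form" "flats (w # ws) = flat w \<and>\<^sub>w flats ws"
  by (simp_all add: flats_def)

lemma flats_append: "flats (us @ ws) = flats us \<and>\<^sub>w flats ws"
  by (induction us) (auto simp: wedge_assoc)

lemma flats_alt: "flats ws \<in> alt_forms (length ws)"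
  by (induction ws) (use wedge_alt[OF flat_alt] in auto)

abbreviation axes :: "'n::finite list \<Rightarrow> (real^'n) list" where
  "axes I \<equiv> map (\<lambda>i. axis i 1) I"

lemma basis_form_flats: "basis_form I = flats (axes I)"
  by (induction I) (auto simp: flat_axis)

lemma wedge_power_alt: "\<xi> \<in> alt_forms k \<Longrightarrow> wedge_power \<xi> s \<in> alt_forms (s * k)"
  by (induction s) (auto intro: wedge_alt)

section \<open>The basis theorem\<close>

text \<open>Absolute values hide the sign of the sorting permutation, and only the vanishing of
  \<open>\<xi> (axes J)\<close> matters for uniqueness.\<close>

lemma abs_alt_insort:
  "\<xi> \<in> alt_forms k \<Longrightarrow> \<bar>\<xi> (axes (insort x J))\<bar> = \<bar>\<xi> (axes (x # J))\<bar>"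
proof (induction J arbitrary: \<xi> k)
  case (Cons y J)
  show ?case
  proof (cases "x \<le> y")
    case False
    have "\<bar>\<xi> (axes (insort x (y # J)))\<bar> = \<bar>iota (axis y 1) \<xi> (axes (insort x J))\<bar>"
      using False by (simp add: iota_def)
    also have "\<dots> = \<bar>iota (axis x 1) (iota (axis y 1) \<xi>) (axes J)\<bar>"
      by (subst Cons.IH[OF iota_alt_pred[OF Cons.prems]]) (simp add: iota_def)
    also have "\<dots> = \<bar>\<xi> (axes (x # y # J))\<bar>"
      by (subst iota_anticommute[OF Cons.prems]) (simp add: iota_def)
    finally show ?thesis .
  qed auto
qed auto

lemma abs_alt_sort: "\<xi> \<in> alt_forms k \<Longrightarrow> \<bar>\<xi> (axes (sort J))\<bar> = \<bar>\<xi> (axes J)\<bar>"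
proof (induction J arbitrary: \<xi> k)
  case (Cons y J)
  have "\<bar>\<xi> (axes (sort (y # J)))\<bar> = \<bar>iota (axis y 1) \<xi> (axes (sort J))\<bar>"
    using abs_alt_insort[OF Cons.prems] by (simp add: iota_def)
  also have "\<dots> = \<bar>\<xi> (axes (y # J))\<bar>"
    by (subst Cons.IH[OF iota_alt_pred[OF Cons.prems]]) (simp add: iota_def)
  finally show ?case .
qed auto

lemma sorted_distinct_multi_index:
  "sorted J \<Longrightarrow> distinct J \<Longrightarrow> length J = k \<Longrightarrow> J \<in> multi_indices k"
  by (simp add: multi_indices_def strict_sorted_iff)

lemma alt_zero_if_repeated:
  assumes "\<xi> \<in> alt_forms k" "\<not> distinct vs" shows "\<xi> vs = 0"
proof -
  obtain i j where ij: "i < j" "j < length vs" "vs ! i = vs ! j"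
    using assms(2) by (metis distinct_conv_nth linorder_neqE_nat)
  show ?thesis
  proof (cases "length vs = k")
    case True
    then show ?thesis using assms(1) ij unfolding alt_forms_def by blast
  qed (use assms in \<open>simp add: alt_forms_length\<close>)
qed

lemma alt_zero_axes:
  fixes \<xi> :: "'n::{finite,linorder} form"
  assumes "\<xi> \<in> alt_forms k" "\<And>K. K \<in> multi_indices k \<Longrightarrow> \<xi> (axes K) = 0"
  shows "\<xi> (axes J) = 0"
proof (cases "distinct J \<and> length J = k")
  case True
  then have "\<xi> (axes (sort J)) = 0"
    by (intro assms sorted_distinct_multi_index) auto
  then show ?thesis using abs_alt_sort[OF assms(1), of J] by simp
next
  case False
  then show ?thesis
    using alt_forms_length[OF assms(1)] alt_zero_if_repeated[OF assms(1), of "axes J"]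
    by (auto simp: distinct_map)
qed

lemma multilinear_zero_axes:
  assumes "\<xi> \<in> alt_forms k" "\<And>J. \<xi> (axes J) = 0"
  shows "\<xi> vs = 0"
  using assms
proof (induction vs arbitrary: \<xi> k)
  case Nil
  from Nil(2)[of "[]"] show ?case by simp
next
  case (Cons v vs)
  have "\<xi> (v # vs) = \<xi> ((\<Sum>i\<in>UNIV. v $ i *\<^sub>R axis i 1) # vs)"
    by (simp add: basis_expansion flip: scalar_mult_eq_scaleR)
  also have "\<dots> = (\<Sum>i\<in>UNIV. v $ i * iota (axis i 1) \<xi> vs)"
    by (simp add: linear_sum[OF linear_Cons[OF Cons.prems(1)]] linear_scale[OF linear_Cons[OF Cons.prems(1)]] iota_def)
  also have "\<dots> = 0"
  proof (intro sum.neutral ballI)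
    fix i :: 'a
    have "iota (axis i 1) \<xi> vs = 0"
      using Cons.prems(2)[of "i # _"] by (intro Cons.IH[OF iota_alt_pred[OF Cons.prems(1)]]) (simp add: iota_def)
    then show "v $ i * iota (axis i 1) \<xi> vs = 0" by simp
  qed
  finally show ?case .
qed

text \<open>The values on increasing lists of basis vectors determine an alternating form: any list of basis
  vectors is either not distinct or can be sorted, and the general case follows by linearity.\<close>

lemma alt_forms_eqI:
  fixes \<xi> :: "'n::{finite,linorder} form"
  assumes "\<xi> \<in> alt_forms k" "\<eta> \<in> alt_forms k"
    and "\<And>K. K \<in> multi_indices k \<Longrightarrow> \<xi> (axes K) = \<eta> (axes K)"
  shows "\<xi> = \<eta>"
proof -
  have d: "\<xi> - \<eta> \<in> alt_forms k" using assms(1,2) by (rule alt_forms_diff)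
  have "(\<xi> - \<eta>) (axes J) = 0" for J
    by (rule alt_zero_axes[OF d]) (simp add: assms(3))
  then have "(\<xi> - \<eta>) vs = 0" for vs
    by (rule multilinear_zero_axes[OF d])
  then show ?thesis by (auto simp: fun_eq_iff)
qed

lemma flat_wedge_axes_notin: "i \<notin> set J \<Longrightarrow> (flat (axis i 1) \<and>\<^sub>w \<theta>) (axes J) = 0"
  by (induction J arbitrary: \<theta>) (auto simp: wedge_Cons inner_axis_axis wedge_scale_left)

lemma iota_flats_notin: "j \<notin> set I \<Longrightarrow> iota (axis j 1) (flats (axes I)) = 0"
  by (induction I) (auto simp: iota_wedge inner_axis_axis)

lemma flats_axes_basis:
  fixes I J :: "'n::{finite,linorder} list"
  assumes "I \<in> multi_indices k" "J \<in> multi_indices k"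
  shows "flats (axes I) (axes J) = of_bool (I = J)"
  using assms
proof (induction k arbitrary: I J)
  case 0 then show ?case by (auto simp: multi_indices_def unit_form_def)
next
  case (Suc k)
  then obtain i I' j J' where [simp]: "I = i # I'" "J = j # J'"
    by (auto simp: multi_indices_def length_Suc_conv)
  have *: "I' \<in> multi_indices k" "J' \<in> multi_indices k" "i \<notin> set I'" "j \<notin> set J'"
    "i < j \<Longrightarrow> i \<notin> set J'" "j < i \<Longrightarrow> j \<notin> set I'"
    using Suc.prems by (auto simp: multi_indices_def)
  have eq: "flats (axes I) (axes J) = of_bool (i = j) * flats (axes I') (axes J')
    - (flat (axis i 1) \<and>\<^sub>w iota (axis j 1) (flats (axes I'))) (axes J')"
    by (simp add: wedge_Cons inner_axis_axis wedge_scale_left)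
  consider "i = j" | "i < j" | "j < i" by fastforce
  then show ?case
  proof cases
    case 1
    then show ?thesis unfolding eq using * Suc.IH by (simp add: iota_flats_notin)
  next
    case 2
    then show ?thesis unfolding eq using * by (auto simp: flat_wedge_axes_notin)
  next
    case 3
    then show ?thesis unfolding eq using * by (auto simp: iota_flats_notin)
  qed
qed

lemma finite_multi_indices [simp]: "finite (multi_indices k)"
  by (rule finite_subset[OF _ finite_lists_length_eq[OF finite_class.finite_UNIV, of k]]) (auto simp: multi_indices_def)

lemma basis_expansion_alt:
  fixes \<xi> :: "'n::{finite,linorder} form"
  assumes "\<xi> \<in> alt_forms k"
  shows "\<xi> = (\<Sum>I\<in>multi_indices k. \<xi> (axes I) *\<^sub>R flats (axes I))"
proof (rule alt_forms_eqI[OF assms])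
  show "(\<Sum>I\<in>multi_indices k. \<xi> (axes I) *\<^sub>R flats (axes I)) \<in> alt_forms k"
    by (intro alt_forms_sum alt_forms_scale) (auto simp: multi_indices_def intro: flats_alt[of "axes _", simplified])
  show "\<xi> (axes K) = (\<Sum>I\<in>multi_indices k. \<xi> (axes I) *\<^sub>R flats (axes I)) (axes K)"
    if "K \<in> multi_indices k" for K
    using that by (simp add: sum_fun_apply flats_axes_basis)
qed

lemma flats_alt': "length ws = k \<Longrightarrow> flats ws \<in> alt_forms k"
  using flats_alt by blast

section \<open>Wedge products as functions of their factors\<close>

text \<open>Wedge products are now regarded as functions of the vectors that define their 1-form factors.
  The fixed factors \<open>\<eta>s\<close> are the basis forms \<open>e\<^sup>I\<close> in powers of \<open>\<pi> X\<close>, and units for plain products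
  \<open>flats ws\<close>.\<close>

fun wprod :: "'n::finite form list \<Rightarrow> (real^'n) list \<Rightarrow> 'n form" where
  "wprod [] [] = unit_form"
| "wprod (\<eta> # \<eta>s) (w # ws) = \<eta> \<and>\<^sub>w flat w \<and>\<^sub>w wprod \<eta>s ws"
| "wprod _ _ = 0"

lemma wedge_param_alt:
  assumes "\<And>vs. (\<lambda>ws. h ws vs) \<in> alt_forms k"
  shows "(\<lambda>ws. (\<eta> \<and>\<^sub>w h ws) vs) \<in> alt_forms k"
proof -
  have "(\<lambda>ws. (\<eta> \<and>\<^sub>w h ws) vs) = (\<Sum>S\<in>Pow {..<length vs}.
     (shuffle_sign S * \<eta> (nths vs S)) *\<^sub>R (\<lambda>ws. h ws (nths vs (- S))))"
    by (rule ext) (simp add: wedge_def sum_fun_apply)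
  then show ?thesis using assms by (simp add: alt_forms_sum alt_forms_scale)
qed

lemma flat_wedge_sandwich: "flat w \<and>\<^sub>w \<eta> \<and>\<^sub>w flat w \<and>\<^sub>w \<beta> = 0"
proof -
  have "flat w \<and>\<^sub>w \<eta> \<and>\<^sub>w flat w \<and>\<^sub>w \<beta> = (flat w \<and>\<^sub>w \<eta>) \<and>\<^sub>w flat w \<and>\<^sub>w \<beta>" by (simp add: wedge_assoc)
  also have "\<dots> = parity \<eta> \<and>\<^sub>w flat w \<and>\<^sub>w flat w \<and>\<^sub>w \<beta>"
    by (simp add: flat_wedge_commute[of w \<eta>] wedge_assoc del: flat_wedge_twice)
  finally show ?thesis by simp
qed

text \<open>The forms between two equal 1-forms do not matter: moving a 1-form past them only changes a sign,
  and its square vanishes.\<close>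

lemma wprod_alternating: "(\<lambda>ws. wprod \<eta>s ws vs) \<in> alt_forms (length \<eta>s)"
proof (induction \<eta>s arbitrary: vs)
  case Nil
  have "wprod [] ws vs = (unit_form vs *\<^sub>R unit_form) ws" for ws
    by (cases ws) (auto simp: unit_form_def)
  then have "(\<lambda>ws. wprod [] ws vs) = unit_form vs *\<^sub>R unit_form" by (rule ext)
  then show ?case by (simp add: alt_forms_scale)
next
  case (Cons \<eta> \<eta>s)
  have "linear (\<lambda>w. wprod (\<eta> # \<eta>s) (w # ws) vs)" for ws
    by (intro linear_compose[OF _ linear_fun_eval[of vs], unfolded o_def], simp)
       (intro linear_compose[OF _ linear_wedge_right, unfolded o_def]
           linear_compose[OF linear_flat linear_wedge_left, unfolded o_def])
  moreover have "wprod (\<eta> # \<eta>s) (w # w # ws) vs = 0" for w ws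
    by (cases \<eta>s) (auto simp: flat_wedge_sandwich)
  moreover have "iota w (\<lambda>ws. wprod (\<eta> # \<eta>s) ws vs) \<in> alt_forms (length \<eta>s)" for w
    using wedge_param_alt[of "wprod \<eta>s", OF Cons.IH] by (simp add: iota_def flip: wedge_assoc)
  ultimately show ?case by (simp add: alt_forms_Suc)
qed

lemma flats_wprod: "flats ws = wprod (replicate (length ws) unit_form) ws"
  by (induction ws) auto

lemma flats_alternating: "(\<lambda>ws. flats ws vs) \<in> alt_forms (length vs)"
proof -
  have "flats ws vs = wprod (replicate (length vs) unit_form) ws vs" for ws
  proof (cases "length ws = length vs")
    case True then show ?thesis by (simp add: flats_wprod)
  next
    case False
    then show ?thesis
      using alt_forms_length[OF flats_alt[of ws], of vs]
        alt_forms_length[OF wprod_alternating[of "replicate (length vs) unit_form" vs], of ws] by auto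
  qed
  then show ?thesis using wprod_alternating[of "replicate (length vs) unit_form" vs] by (simp add: fun_eq_iff)
qed

lemma flats_alternating': "length vs = k \<Longrightarrow> (\<lambda>ws. flats ws vs) \<in> alt_forms k"
  using flats_alternating by blast

lemma length_multi_index: "I \<in> multi_indices k \<Longrightarrow> length I = k"
  by (simp add: multi_indices_def)

text \<open>A product of 1-forms, paired with an alternating \<open>q\<close> over increasing multiindices, gives the value
  of \<open>q\<close> at the corresponding vectors. Both sides are alternating in these vectors, so it is enough to
  compare them at increasing lists of basis vectors.\<close>

lemma pairing_flats:
  fixes q :: "'n::{finite,linorder} form"
  assumes "q \<in> alt_forms m"
  shows "(\<Sum>K\<in>multi_indices m. q (axes K) * flats vs (axes K)) = q vs"
proof -
  have "(\<Sum>K\<in>multi_indices m. q (axes K) *\<^sub>R (\<lambda>vs. flats vs (axes K))) = q"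
  proof (rule alt_forms_eqI[OF _ assms])
    show "(\<Sum>K\<in>multi_indices m. q (axes K) *\<^sub>R (\<lambda>vs. flats vs (axes K))) \<in> alt_forms m"
      by (intro alt_forms_sum alt_forms_scale flats_alternating') (simp add: length_multi_index)
  qed (simp add: sum_fun_apply flats_axes_basis)
  from fun_cong[OF this, of vs] show ?thesis by (simp add: sum_fun_apply)
qed

text \<open>A case of the symmetry of determinants under transposition.\<close>

lemma flats_axes_sym:
  fixes K :: "'n::{finite,linorder} list"
  assumes "K \<in> multi_indices m"
  shows "flats (axes K) vs = flats vs (axes K)"
proof -
  have "flats (axes K) = (\<lambda>vs. flats vs (axes K))"
    using assms by (intro alt_forms_eqI[of _ m] flats_alternating' flats_alt') (auto simp: flats_axes_basis length_multi_index)
  then show ?thesis by (rule fun_cong)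
qed

section \<open>Pullbacks along matrices\<close>

text \<open>\<open>row_comb X\<close> is the linear map of the transpose of \<open>X\<close>; it sends the basis vector \<open>r\<close> to the row
  \<open>r\<close>. The minors of \<open>X\<close> are the coefficients of the pullbacks of basis forms along it.\<close>

definition row_comb :: "real^'n^'N::finite \<Rightarrow> real^'N \<Rightarrow> real^'n::finite" where
  "row_comb X w = (\<Sum>r\<in>UNIV. w $ r *\<^sub>R X $ r)"

definition pullback :: "real^'n^'N \<Rightarrow> 'n::finite form \<Rightarrow> 'N::finite form" where
  "pullback X \<theta> = (\<lambda>ws. \<theta> (map (row_comb X) ws))"

definition outer :: "real^'N \<Rightarrow> real^'n \<Rightarrow> real^'n::finite^'N::finite" where
  "outer a b = (\<chi> r i. a $ r * b $ i)"

lemma outer_nth [simp]: "outer a b $ r = a $ r *\<^sub>R b"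
  by (simp add: outer_def vec_eq_iff)

lemma outer_scale_left: "outer (c *\<^sub>R a) b = c *\<^sub>R outer a b"
  by (simp add: vec_eq_iff)

lemma row_comb_linear_arg: "linear (row_comb X)"
  by (rule linearI) (simp_all add: row_comb_def algebra_simps sum.distrib scaleR_sum_right)

lemma row_comb_linear_mat: "linear (\<lambda>X. row_comb X w)"
  by (rule linearI) (simp_all add: row_comb_def algebra_simps sum.distrib scaleR_sum_right)

lemma row_comb_axis [simp]: "row_comb X (axis r 1) = X $ r"
proof -
  have "row_comb X (axis r 1) = (\<Sum>r'\<in>UNIV. if r' = r then X $ r' else 0)"
    unfolding row_comb_def by (intro sum.cong) (auto simp: axis_def)
  then show ?thesis by simp
qed

lemma row_comb_outer [simp]: "row_comb (outer a b) w = (a \<bullet> w) *\<^sub>R b"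
  by (simp add: row_comb_def inner_vec_def scaleR_sum_left mult.commute)

lemma iota_pullback: "iota w (pullback X \<theta>) = pullback X (iota (row_comb X w) \<theta>)"
  by (simp add: iota_def pullback_def)

lemma linear_pullback: "linear (pullback X)"
  by (rule linearI) (auto simp: pullback_def fun_eq_iff)

lemmas pullback_simps [simp] = linear_add [OF linear_pullback] linear_scale [OF linear_pullback]
  linear_0 [OF linear_pullback] linear_neg [OF linear_pullback]

lemma pullback_Nil [simp]: "pullback X \<theta> [] = \<theta> []"
  by (simp add: pullback_def)

lemma pullback_Cons: "pullback X \<theta> (w # ws) = pullback X (iota (row_comb X w) \<theta>) ws"
  by (simp add: pullback_def iota_def)

lemma pullback_axes: "pullback X \<theta> (axes I) = \<theta> (map (($) X) I)"
  by (simp add: pullback_def comp_def)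

lemma pullback_alt: "\<theta> \<in> alt_forms p \<Longrightarrow> pullback X \<theta> \<in> alt_forms p"
proof (induction p arbitrary: \<theta>)
  case 0
  then show ?case by (auto simp: alt_forms_def pullback_def)
next
  case (Suc p)
  have "linear (\<lambda>w. pullback X \<theta> (w # ws))" for ws
    using linear_compose[OF row_comb_linear_arg linear_Cons[OF Suc.prems]] by (simp add: pullback_def o_def)
  then show ?case
    using Suc by (auto simp: alt_forms_Suc iota_pullback) (auto simp: pullback_def)
qed

lemma iota_add: "\<theta> \<in> alt_forms p \<Longrightarrow> iota (v + w) \<theta> = iota v \<theta> + iota w \<theta>"
  and iota_scale: "\<theta> \<in> alt_forms p \<Longrightarrow> iota (c *\<^sub>R v) \<theta> = c *\<^sub>R iota v \<theta>"
  and iota_sum: "\<theta> \<in> alt_forms p \<Longrightarrow> iota (sum g A) \<theta> = (\<Sum>x\<in>A. iota (g x) \<theta>)"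
  using linear_add[OF linear_iota] linear_scale[OF linear_iota] linear_sum[OF linear_iota] by auto

text \<open>A rank-one update changes a pullback by a term that is linear in \<open>a\<close>, since \<open>b\<close> can be inserted into
  an alternating form only once. In particular minors are affine along rank-one lines.\<close>

lemma pullback_rank_one:
  assumes "\<theta> \<in> alt_forms p"
  shows "pullback (Y + outer a b) \<theta> = pullback Y \<theta> + flat a \<and>\<^sub>w pullback Y (iota b \<theta>)"
proof
  show "pullback (Y + outer a b) \<theta> ws = (pullback Y \<theta> + flat a \<and>\<^sub>w pullback Y (iota b \<theta>)) ws" for ws
    using assms
  proof (induction ws arbitrary: \<theta> p)
    case (Cons w ws)
    let ?v = "row_comb Y w"
    have "pullback (Y + outer a b) \<theta> (w # ws)
        = pullback (Y + outer a b) (iota ?v \<theta>) ws + (a \<bullet> w) * pullback (Y + outer a b) (iota b \<theta>) ws"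
      using iota_add[OF Cons.prems] iota_scale[OF Cons.prems]
      by (simp add: pullback_Cons linear_add[OF row_comb_linear_mat])
    also have "\<dots> = pullback Y (iota ?v \<theta>) ws - (flat a \<and>\<^sub>w pullback Y (iota ?v (iota b \<theta>))) ws
        + (a \<bullet> w) * pullback Y (iota b \<theta>) ws"
      unfolding Cons.IH[OF iota_alt_pred[OF Cons.prems]] iota_iota_self[OF Cons.prems]
        iota_anticommute[OF Cons.prems, of b ?v]
      by simp
    also have "\<dots> = (pullback Y \<theta> + flat a \<and>\<^sub>w pullback Y (iota b \<theta>)) (w # ws)"
      by (simp add: pullback_Cons wedge_Cons iota_pullback wedge_scale_left)
    finally show ?case .
  qed simp
qed

text \<open>Euler's identity for the \<open>p\<close>-homogeneous function \<open>X \<mapsto> pullback X \<theta>\<close>. It peels off one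
  rank-one summand of \<open>X\<close> at a time and so replaces an expansion over \<open>p\<close>-tuples.\<close>

lemma euler_pullback:
  fixes c :: "'i \<Rightarrow> real"
  assumes "\<theta> \<in> alt_forms p" and X: "X = (\<Sum>K\<in>A. c K *\<^sub>R outer (a K) (b K))"
  shows "(\<Sum>K\<in>A. c K *\<^sub>R (flat (a K) \<and>\<^sub>w pullback X (iota (b K) \<theta>))) = real p *\<^sub>R pullback X \<theta>"
proof
  have "(\<Sum>K\<in>A. c K *\<^sub>R (flat (a K) \<and>\<^sub>w pullback X (iota (b K) \<theta>))) ws = real (length ws) * pullback X \<theta> ws" for ws
    using assms(1)
  proof (induction ws arbitrary: \<theta> p)
    case (Cons w ws)
    let ?v = "row_comb X w"
    have v: "?v = (\<Sum>K\<in>A. (c K * (a K \<bullet> w)) *\<^sub>R b K)"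
      unfolding X by (simp add: linear_sum[OF row_comb_linear_mat] linear_scale[OF row_comb_linear_mat])
    have 1: "(\<Sum>K\<in>A. c K * (a K \<bullet> w) * pullback X (iota (b K) \<theta>) ws) = pullback X (iota ?v \<theta>) ws"
      unfolding v iota_sum[OF Cons.prems] linear_sum[OF linear_pullback]
      by (simp add: iota_scale[OF Cons.prems] sum_fun_apply)
    have 2: "(flat (a K) \<and>\<^sub>w pullback X (iota ?v (iota (b K) \<theta>))) ws
        = - (flat (a K) \<and>\<^sub>w pullback X (iota (b K) (iota ?v \<theta>))) ws" for K
      by (subst iota_anticommute[OF Cons.prems]) simp
    have "(\<Sum>K\<in>A. c K *\<^sub>R (flat (a K) \<and>\<^sub>w pullback X (iota (b K) \<theta>))) (w # ws)
      = (\<Sum>K\<in>A. c K * (a K \<bullet> w) * pullback X (iota (b K) \<theta>) ws)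
      + (\<Sum>K\<in>A. c K *\<^sub>R (flat (a K) \<and>\<^sub>w pullback X (iota (b K) (iota ?v \<theta>)))) ws"
      by (simp add: sum_fun_apply wedge_Cons iota_pullback wedge_scale_left 2 algebra_simps sum.distrib)
    also have "\<dots> = real (length (w # ws)) * pullback X \<theta> (w # ws)"
      unfolding 1 Cons.IH[OF iota_alt_pred[OF Cons.prems]] by (simp add: pullback_Cons algebra_simps)
    finally show ?case .
  qed (simp add: sum_fun_apply)
  then show "(\<Sum>K\<in>A. c K *\<^sub>R (flat (a K) \<and>\<^sub>w pullback X (iota (b K) \<theta>))) ws = (real p *\<^sub>R pullback X \<theta>) ws" for ws
    using alt_forms_length[OF pullback_alt[OF assms(1)], of ws X] by (cases "length ws = p") auto
qed

definition outers :: "(real^'N) list \<Rightarrow> (real^'n) list \<Rightarrow> real^'n::finite^'N::finite" where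
  "outers as bs = sum_list (map2 outer as bs)"

lemma pullback_zero_matrix: "\<theta> \<in> alt_forms p \<Longrightarrow> 0 < p \<Longrightarrow> pullback 0 \<theta> = 0"
proof
  show "\<theta> \<in> alt_forms p \<Longrightarrow> 0 < p \<Longrightarrow> pullback 0 \<theta> ws = (0 :: 'b form) ws" for ws
    by (cases ws) (auto simp: alt_forms_length pullback_def linear_0[OF row_comb_linear_mat] linear_0[OF linear_Cons])
qed

text \<open>A sum of fewer than \<open>p\<close> rank-one matrices has rank less than \<open>p\<close>, hence no minors of order \<open>p\<close>.\<close>

lemma pullback_outers_few:
  assumes "length as = length bs" "length bs < p" "\<theta> \<in> alt_forms p"
  shows "pullback (outers as bs) \<theta> = 0"
  using assms
proof (induction as bs arbitrary: \<theta> p rule: list_induct2)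
  case Nil then show ?case by (simp add: outers_def pullback_zero_matrix)
next
  case (Cons a as b bs)
  have "outers (a # as) (b # bs) = outers as bs + outer a b" by (simp add: outers_def)
  moreover have "iota b \<theta> \<in> alt_forms (p - 1)" by (rule iota_alt_pred[OF Cons.prems(2)])
  then have "pullback (outers as bs) (iota b \<theta>) = 0"
    using Cons.prems by (intro Cons.IH[of "p - 1"]) auto
  moreover have "pullback (outers as bs) \<theta> = 0"
    using Cons.prems by (intro Cons.IH[of p]) auto
  ultimately show ?case
    by (simp only: pullback_rank_one[OF Cons.prems(2)]) simp
qed

text \<open>The Cauchy-Binet formula for a sum of exactly \<open>p\<close> rank-one matrices.\<close>

lemma pullback_outers:
  assumes "length as = length bs" "\<theta> \<in> alt_forms (length bs)"
  shows "pullback (outers as bs) \<theta> = \<theta> bs *\<^sub>R flats as"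
  using assms
proof (induction as bs arbitrary: \<theta> rule: list_induct2)
  case Nil
  then obtain c where "\<theta> = c *\<^sub>R unit_form" by (auto simp: alt_forms_zero)
  then show ?case by (auto simp: fun_eq_iff pullback_def unit_form_def)
next
  case (Cons a as b bs)
  have th: "\<theta> \<in> alt_forms (Suc (length bs))" using Cons.prems by simp
  have "outers (a # as) (b # bs) = outers as bs + outer a b" by (simp add: outers_def)
  then show ?case
    unfolding pullback_rank_one[OF th] pullback_outers_few[OF Cons.hyps lessI th] Cons.IH[OF iota_alt[OF th]]
      \<open>outers (a # as) (b # bs) = _\<close>
    by (simp add: wedge_scale_right) (simp add: iota_def)
qed

section \<open>Minors\<close>

text \<open>The determinant in \<open>adj\<close> is identified with a value of \<open>flats (axes J)\<close> through uniqueness of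
  alternating forms, which avoids a Laplace expansion of the sum over permutations.\<close>

definition leibniz :: "'n list \<Rightarrow> (real^'n) list \<Rightarrow> real" where
  "leibniz J vs = (if length vs = length J then
     \<Sum>p | p permutes {..<length J}. of_int (sign p) * (\<Prod>a<length J. vs ! a $ (J ! p a)) else 0)"

lemma leibniz_alt: "leibniz J \<in> alt_forms (length J)"
proof -
  let ?s = "length J"
  have "linear (\<lambda>x. leibniz J (vs[i := x]))" if "length vs = ?s" "i < ?s" for vs i
  proof -
    have "leibniz J (vs[i := x]) = (\<Sum>p | p permutes {..<?s}. (of_int (sign p) *
       (\<Prod>a\<in>{..<?s} - {i}. vs ! a $ (J ! p a))) * x $ (J ! p i))" for x
    proof -
      have "(\<Prod>a<?s. vs[i := x] ! a $ (J ! p a)) = x $ (J ! p i) * (\<Prod>a\<in>{..<?s} - {i}. vs ! a $ (J ! p a))" for p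
        using that by (subst prod.remove[of _ i]) (auto intro!: prod.cong)
      then show ?thesis using that by (simp add: leibniz_def mult_ac)
    qed
    moreover have "linear (\<lambda>x. \<Sum>p\<in>A. c p * x $ d p)" for A and c :: "(nat \<Rightarrow> nat) \<Rightarrow> real" and d :: "_ \<Rightarrow> 'a"
      by (rule linearI) (simp_all add: sum.distrib distrib_left sum_distrib_left mult.left_commute)
    ultimately show ?thesis by simp
  qed
  moreover have "leibniz J vs = 0" if vs: "length vs = ?s" "i < j" "j < ?s" "vs ! i = vs ! j" for vs i j
  proof -
    let ?P = "{p. p permutes {..<?s}}"
    let ?t = "Transposition.transpose i j"
    let ?g = "\<lambda>p. of_int (sign p) * (\<Prod>a<?s. vs ! a $ (J ! p a)) :: real"
    have t: "?t permutes {..<?s}" using that by (intro permutes_swap_id) auto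
    have "sum ?g ?P = (\<Sum>p\<in>?P. ?g (p \<circ> ?t))"
      by (rule sum.reindex_bij_witness[of _ "\<lambda>p. p \<circ> ?t" "\<lambda>p. p \<circ> ?t"])
        (auto simp: o_assoc[symmetric] permutes_compose[OF t])
    also have "\<dots> = (\<Sum>p\<in>?P. - ?g p)"
    proof (intro sum.cong refl)
      fix p assume p: "p \<in> ?P"
      have "permutation p" "permutation ?t" using p t by (auto intro: permutes_imp_permutation[of "{..<?s}"])
      then have "sign (p \<circ> ?t) = - sign p" using that by (simp add: sign_compose sign_swap_id)
      moreover have "(\<Prod>a<?s. vs ! a $ (J ! (p \<circ> ?t) a)) = (\<Prod>a<?s. vs ! ?t a $ (J ! p a))"
        by (rule prod.reindex_bij_witness[of _ ?t ?t]) (use permutes_in_image[OF t] in auto)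
      moreover have "vs ! ?t a = vs ! a" for a using vs(4) by (auto simp: Transposition.transpose_def)
      ultimately show "?g (p \<circ> ?t) = - ?g p" by simp
    qed
    also have "\<dots> = - sum ?g ?P" by (simp add: sum_negf)
    finally show ?thesis using vs by (simp add: leibniz_def)
  qed
  ultimately show ?thesis by (auto simp: alt_forms_def leibniz_def)
qed

text \<open>A nonzero term makes \<open>K\<close> a rearrangement of \<open>J\<close>; both lists increase, so they agree and the
  permutation is the identity.\<close>

lemma leibniz_axes:
  fixes J K :: "'n::{finite,linorder} list"
  assumes "J \<in> multi_indices s" "K \<in> multi_indices s"
  shows "leibniz J (axes K) = of_bool (J = K)"
proof -
  have len: "length J = s" "length K = s" and sd: "sorted J" "sorted K" "distinct J" "distinct K"
    using assms by (simp_all add: multi_indices_def strict_sorted_iff)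
  let ?g = "\<lambda>p. of_int (sign p) * (\<Prod>a<s. axes K ! a $ (J ! p a)) :: real"
  have 0: "?g p = 0" if p: "p permutes {..<s}" and ne: "\<not> (J = K \<and> p = id)" for p
  proof (rule ccontr)
    assume g: "?g p \<noteq> 0"
    have *: "K ! a = J ! p a" if a: "a < s" for a
    proof (rule ccontr)
      assume "K ! a \<noteq> J ! p a"
      then have "axes K ! a $ (J ! p a) = 0" using a len by (auto simp: axis_def)
      then have "(\<Prod>a<s. axes K ! a $ (J ! p a)) = 0" using a by (intro prod_zero) auto
      then show False using g by simp
    qed
    have "set K \<subseteq> set J"
    proof
      fix x assume "x \<in> set K"
      then obtain a where "a < s" "x = K ! a" using len by (auto simp: in_set_conv_nth)
      then show "x \<in> set J" using * len permutes_in_image[OF p, of a] by simp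
    qed
    moreover have "card (set K) = card (set J)" using sd len by (simp add: distinct_card)
    ultimately have "set K = set J" by (simp add: card_subset_eq)
    then have eq: "J = K" using sd by (metis sorted_distinct_set_unique)
    have "p a = a" for a
    proof (cases "a < s")
      case True
      then show ?thesis
        using *[OF True] eq sd len permutes_in_image[OF p, of a] by (auto simp: nth_eq_iff_index_eq)
    next
      case False then show ?thesis using p by (simp add: permutes_def)
    qed
    then show False using eq ne by (auto simp: fun_eq_iff)
  qed
  have fin: "finite {p. p permutes {..<s}}" by (simp add: finite_permutations)
  have "sum ?g {p. p permutes {..<s}} = of_bool (J = K)"
  proof (cases "J = K")
    case True
    have "sum ?g {p. p permutes {..<s}} = sum ?g {id}"
      by (rule sum.mono_neutral_right[OF fin]) (use 0 in \<open>auto simp: permutes_id\<close>)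
    then show ?thesis using True len by (simp add: axis_def)
  next
    case False then show ?thesis using 0 by (simp add: sum.neutral)
  qed
  then show ?thesis using len by (simp add: leibniz_def)
qed

lemma leibniz_flats:
  fixes J :: "'n::{finite,linorder} list"
  assumes "J \<in> multi_indices s"
  shows "leibniz J = flats (axes J)"
  using assms leibniz_alt[of J] length_multi_index[OF assms]
  by (intro alt_forms_eqI[of _ s] flats_alt') (auto simp: flats_axes_basis leibniz_axes)

lemma adj_eq_pullback:
  assumes "I \<in> multi_indices s" "J \<in> multi_indices s"
  shows "adj X s I J = pullback X (flats (axes J)) (axes I)"
proof -
  have "adj X s I J = leibniz J (map (($) X) I)"
    using assms by (simp add: adj_def leibniz_def length_multi_index)
  then show ?thesis using assms by (simp add: leibniz_flats pullback_axes)
qed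

lemma adj_off: "\<not> (I \<in> multi_indices s \<and> J \<in> multi_indices s) \<Longrightarrow> adj X s I J = 0"
  by (auto simp: adj_def)

section \<open>The projection and a linear section of it\<close>

lemma card_multi_indices: "card (multi_indices k :: 'n::{finite,linorder} list set) = CARD('n) choose k"
proof -
  have "bij_betw set (multi_indices k :: 'n list set) {B. B \<subseteq> UNIV \<and> card B = k}"
    by (rule bij_betw_byWitness[where f' = sorted_list_of_set])
      (auto simp: multi_indices_def strict_sorted_iff distinct_card sorted_list_of_set.idem_if_sorted_distinct)
  then show ?thesis using n_subsets[of "UNIV :: 'n set" k] by (simp add: bij_betw_same_card)
qed

text \<open>\<open>row_index k\<close> enumerates the multiindices, by composing the rank of a row with the position in the
  sorted list.\<close>

lemma bij_rank: "bij_betw (\<lambda>r::'N::{finite,linorder}. card {r'. r' < r}) UNIV {..<CARD('N)}"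
proof -
  have less: "card {r'. r' < r} < card {r'. r' < q}" if "r < q" for r q :: 'N
    using that by (intro psubset_card_mono) auto
  have "inj (\<lambda>r::'N. card {r'. r' < r})"
    using less by (metis (mono_tags, lifting) injI less_irrefl neqE)
  moreover have "card {r'. r' < r} < CARD('N)" for r :: 'N
    by (intro psubset_card_mono) auto
  ultimately show ?thesis
    unfolding bij_betw_def by (intro conjI card_subset_eq) (auto simp: card_image)
qed

lemma bij_row_index:
  assumes "CARD('N) = CARD('n) choose (k - 1)"
  shows "bij_betw (row_index k :: 'N::{finite,linorder} \<Rightarrow> 'n::{finite,linorder} list) UNIV (multi_indices (k - 1))"
proof -
  let ?L = "sorted_list_of_set (multi_indices (k - 1) :: 'n list set)"
  have "bij_betw ((!) ?L) {..<CARD('N)} (multi_indices (k - 1))"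
    using assms by (intro bij_betw_nth) (auto simp: card_multi_indices)
  from bij_betw_trans[OF bij_rank this] show ?thesis
    by (simp add: row_index_def[abs_def] comp_def)
qed

definition row_coeffs :: "('N \<Rightarrow> 'n::finite list) \<Rightarrow> 'n form \<Rightarrow> real^'N::finite" where
  "row_coeffs idx \<alpha> = (\<chi> r. \<alpha> (axes (idx r)))"

text \<open>A linear section of \<open>proj k\<close>: the basis form \<open>e\<^sup>K\<close> is split as the product of its first \<open>k - 1\<close>
  factors with the last one.\<close>

definition lift :: "nat \<Rightarrow> ('N \<Rightarrow> 'n list) \<Rightarrow> 'n form \<Rightarrow> real^'n::{finite,linorder}^'N::finite" where
  "lift k idx \<xi> = (\<Sum>K\<in>multi_indices k. \<xi> (axes K) *\<^sub>R
     outer (row_coeffs idx (flats (axes (butlast K)))) (axis (last K) 1))"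

lemma flat_sum_axes: "(\<Sum>i\<in>UNIV. b $ i *\<^sub>R flat (axis i 1)) = flat b"
proof -
  have "flat b = flat (\<Sum>i\<in>UNIV. b $ i *\<^sub>R axis i 1)"
    by (simp add: basis_expansion flip: scalar_mult_eq_scaleR)
  then show ?thesis by (simp add: linear_sum[OF linear_flat] linear_scale[OF linear_flat])
qed

lemma alt_one_flat:
  fixes \<beta> :: "'n::{finite,linorder} form"
  assumes "\<beta> \<in> alt_forms 1" obtains b where "\<beta> = flat b"
proof
  show "\<beta> = flat (\<chi> i. \<beta> [axis i 1])"
    by (rule alt_forms_eqI[OF assms flat_alt])
      (auto simp: multi_indices_def length_Suc_conv flat_def inner_axis)
qed

lemma proj_eq: "proj k X = (\<Sum>r\<in>UNIV. flats (axes (row_index k r)) \<and>\<^sub>w flat (X $ r))"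
proof -
  have "proj k X = (\<Sum>i\<in>UNIV. \<Sum>r\<in>UNIV. X $ r $ i *\<^sub>R (flats (axes (row_index k r)) \<and>\<^sub>w flat (axis i 1)))"
    by (simp add: proj_def basis_form_flats flat_axis linear_sum[OF linear_wedge_left] wedge_scale_left)
  also have "\<dots> = (\<Sum>r\<in>UNIV. flats (axes (row_index k r)) \<and>\<^sub>w (\<Sum>i\<in>UNIV. X $ r $ i *\<^sub>R flat (axis i 1)))"
    by (subst sum.swap) (simp add: linear_sum[OF linear_wedge_right] wedge_scale_right)
  finally show ?thesis by (simp add: flat_sum_axes)
qed

lemma linear_proj: "linear (proj k)"
  by (rule linearI)
    (simp_all add: proj_eq linear_add[OF linear_flat] linear_scale[OF linear_flat] wedge_add_right
      wedge_scale_right sum.distrib scaleR_sum_right)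

lemma proj_outer: "proj k (outer a b) = (\<Sum>r\<in>UNIV. a $ r *\<^sub>R flats (axes (row_index k r))) \<and>\<^sub>w flat b"
  by (simp add: proj_eq linear_scale[OF linear_flat] wedge_scale_right wedge_scale_left linear_sum[OF linear_wedge_left])

lemma coeff_form_axes: "coeff_form \<xi> I = \<xi> (axes I)"
  by (simp add: coeff_form_def)

text \<open>The sign comes from moving \<open>e\<^sup>i\<close> past the \<open>(k - 1)\<close>-form, as \<open>ext_deriv\<close> puts it first and \<open>proj\<close>
  puts it last.\<close>

lemma ext_deriv_eq:
  fixes idx :: "'N::{finite,linorder} \<Rightarrow> 'n::{finite,linorder} list"
  assumes "idx = row_index k" "bij_betw idx UNIV (multi_indices (k - 1))"
  shows "ext_deriv (k - 1) Dw x = proj k (\<chi> r. (-1) ^ (k - 1) *\<^sub>R Dw (idx r) x)"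
proof -
  have alt: "flats (axes (idx r)) \<in> alt_forms (k - 1)" for r
    using bij_betw_apply[OF assms(2), of r] by (intro flats_alt') (simp add: length_multi_index)
  have "ext_deriv (k - 1) Dw x = (\<Sum>r\<in>UNIV. \<Sum>i\<in>UNIV. (Dw (idx r) x $ i) *\<^sub>R (flat (axis i 1) \<and>\<^sub>w flats (axes (idx r))))"
    unfolding ext_deriv_def sum.reindex_bij_betw[OF assms(2), symmetric]
    by (simp only: basis_form_flats flat_axis)
  also have "\<dots> = (\<Sum>r\<in>UNIV. flat (Dw (idx r) x) \<and>\<^sub>w flats (axes (idx r)))"
    by (subst flat_sum_axes[symmetric]) (simp add: linear_sum[OF linear_wedge_left] wedge_scale_left)
  also have "\<dots> = (\<Sum>r\<in>UNIV. flats (axes (idx r)) \<and>\<^sub>w flat ((-1) ^ (k - 1) *\<^sub>R Dw (idx r) x))"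
    by (simp add: flat_wedge_commute parity_alt[OF alt] wedge_scale_left linear_scale[OF linear_flat] wedge_scale_right)
  finally show ?thesis by (simp add: proj_eq assms(1))
qed

text \<open>The parameter \<open>idx\<close> is a name for \<open>row_index k\<close> that fixes the types of the rows and of the columns;
  the hypothesis on the number of rows enters as bijectivity.\<close>

locale row_numbering =
  fixes k :: nat and idx :: "'N::{finite,linorder} \<Rightarrow> 'n::{finite,linorder} list"
  assumes k: "1 \<le> k" and idx: "idx = row_index k" and bij: "bij_betw idx UNIV (multi_indices (k - 1))"
begin

lemma row_alt: "flats (axes (idx r)) \<in> alt_forms (k - 1)"
  using bij_betw_apply[OF bij, of r] by (intro flats_alt') (simp add: length_multi_index)

lemma proj_alt: "proj k (X :: real^'n::{finite,linorder}^'N::{finite,linorder}) \<in> alt_forms k"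
  unfolding proj_eq idx[symmetric]
proof (rule alt_forms_sum)
  fix r
  show "flats (axes (idx r)) \<and>\<^sub>w flat (X $ r) \<in> alt_forms k"
    using wedge_alt[OF row_alt flat_alt, of r] k by simp
qed

lemma sum_row_coeffs: "\<alpha> \<in> alt_forms (k - 1) \<Longrightarrow> (\<Sum>r\<in>UNIV. row_coeffs idx \<alpha> $ r *\<^sub>R flats (axes (idx r))) = \<alpha>"
  using basis_expansion_alt[of \<alpha> "k - 1"]
  by (simp only: row_coeffs_def vec_lambda_beta
      sum.reindex_bij_betw[OF bij, of "\<lambda>I. \<alpha> (axes I) *\<^sub>R flats (axes I)"])

lemma proj_outer_coeffs: "\<alpha> \<in> alt_forms (k - 1) \<Longrightarrow> proj k (outer (row_coeffs idx \<alpha>) b) = \<alpha> \<and>\<^sub>w flat b"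
  by (simp add: proj_outer sum_row_coeffs flip: idx)

lemma proj_lift:
  assumes "\<xi> \<in> alt_forms k"
  shows "proj k (lift k idx \<xi>) = \<xi>"
proof -
  have "proj k (outer (row_coeffs idx (flats (axes (butlast K)))) (axis (last K) 1)) = flats (axes K)"
    if "K \<in> multi_indices k" for K
  proof -
    have len: "length K = k" using that by (rule length_multi_index)
    then obtain J j where K: "K = J @ [j]" using k by (cases K rule: rev_cases) auto
    then have "flats (axes J) \<in> alt_forms (k - 1)" using len by (intro flats_alt') auto
    from proj_outer_coeffs[OF this, of "axis j 1"] show ?thesis by (simp add: K flats_append)
  qed
  then have "proj k (lift k idx \<xi>) = (\<Sum>K\<in>multi_indices k. \<xi> (axes K) *\<^sub>R flats (axes K))"
    by (simp add: lift_def linear_sum[OF linear_proj] linear_scale[OF linear_proj])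
  then show ?thesis using basis_expansion_alt[OF assms] by simp
qed

section \<open>Rank-one directions\<close>

theorem ext_one_convex_iff_rank_one_convex:
  "ext_one_convex k f \<longleftrightarrow> rank_one_convex (f \<circ> (proj k :: real^'n::{finite,linorder}^'N::{finite,linorder} \<Rightarrow> _))"
proof
  assume f: "ext_one_convex k f"
  show "rank_one_convex (f \<circ> (proj k :: real^'n::{finite,linorder}^'N::{finite,linorder} \<Rightarrow> _))"
    unfolding rank_one_convex_def
  proof (intro allI)
    fix X :: "real^'n::{finite,linorder}^'N::{finite,linorder}" and a :: "real^'N::{finite,linorder}" and b :: "real^'n::{finite,linorder}"
    let ?\<alpha> = "\<Sum>r\<in>UNIV. a $ r *\<^sub>R flats (axes (idx r))"
    have "?\<alpha> \<in> alt_forms (k - 1)" by (intro alt_forms_sum alt_forms_scale row_alt)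
    then have "convex_on UNIV (\<lambda>t::real. f (proj k X + t *\<^sub>R (?\<alpha> \<and>\<^sub>w flat b)))"
      using f[unfolded ext_one_convex_def, rule_format, OF proj_alt _ flat_alt] by blast
    then show "convex_on UNIV (\<lambda>t::real. (f \<circ> proj k) (X + t *\<^sub>R (\<chi> r i. a $ r * b $ i)))"
      unfolding outer_def[symmetric]
      by (simp add: linear_add[OF linear_proj] linear_scale[OF linear_proj] proj_outer idx)
  qed
next
  assume f: "rank_one_convex (f \<circ> (proj k :: real^'n::{finite,linorder}^'N::{finite,linorder} \<Rightarrow> _))"
  show "ext_one_convex k f"
    unfolding ext_one_convex_def
  proof (intro ballI)
    fix \<xi> \<alpha> \<beta> :: "'n form"
    assume \<xi>: "\<xi> \<in> alt_forms k" and \<alpha>: "\<alpha> \<in> alt_forms (k - 1)" and \<beta>: "\<beta> \<in> alt_forms 1"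
    obtain b where b: "\<beta> = flat b" using \<beta> by (rule alt_one_flat)
    have "convex_on UNIV (\<lambda>t::real. (f \<circ> proj k) (lift k idx \<xi> + t *\<^sub>R outer (row_coeffs idx \<alpha>) b))"
      using f by (simp add: rank_one_convex_def outer_def)
    then show "convex_on UNIV (\<lambda>t::real. f (\<xi> + t *\<^sub>R (\<alpha> \<and>\<^sub>w \<beta>)))"
      unfolding b comp_def linear_add[OF linear_proj] linear_scale[OF linear_proj] proj_lift[OF \<xi>]
        proj_outer_coeffs[OF \<alpha>] .
  qed
qed

end

section \<open>Multiples in Sobolev spaces\<close>

text \<open>The sign \<open>(-1)\<^bsup>k-1\<^esup>\<close> between \<open>d\<omega>\<close> and \<open>\<pi> (\<nabla>u)\<close> is absorbed by multiplying functions in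
  \<open>W\<^sub>0\<^sup>1\<^sup>,\<^sup>\<infinity>\<close> by a constant. A nonzero constant leaves the supports of the approximating test
  functions unchanged.\<close>

lemma frechet_derivative_cmult:
  fixes \<phi> :: "real^'n::finite \<Rightarrow> real"
  assumes "\<phi> differentiable (at x)"
  shows "frechet_derivative (\<lambda>x. c * \<phi> x) (at x) = (\<lambda>h. c * frechet_derivative \<phi> (at x) h)"
  using has_derivative_mult_right[OF assms[unfolded frechet_derivative_works], of c]
  by (rule frechet_derivative_at[symmetric])

lemma C_diff_cmult: "C_diff m \<phi> \<Longrightarrow> C_diff m (\<lambda>x. c * \<phi> x)"
  by (induction m arbitrary: \<phi>) (auto intro!: continuous_intros simp: frechet_derivative_cmult)

lemma grad_cmult:
  assumes "\<phi> \<in> test_functions \<Omega>"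
  shows "grad (\<lambda>x. c * \<phi> x) x = c *\<^sub>R grad \<phi> x"
proof -
  have "C_diff (Suc 0) \<phi>" using assms unfolding test_functions_def by blast
  then have "\<phi> differentiable (at x)" by simp
  then show ?thesis by (simp add: grad_def frechet_derivative_cmult vec_eq_iff)
qed

lemma test_functions_cmult:
  assumes "c \<noteq> 0" "\<phi> \<in> test_functions \<Omega>" shows "(\<lambda>x. c * \<phi> x) \<in> test_functions \<Omega>"
  using assms by (auto simp: test_functions_def C_diff_cmult)

lemma weak_gradient_cmult:
  assumes "weak_gradient \<Omega> u Du" shows "weak_gradient \<Omega> (\<lambda>x. c * u x) (\<lambda>x. c *\<^sub>R Du x)"
  using assms unfolding weak_gradient_def by (auto simp: mult.assoc)

lemma W_1_inf_cmult:
  assumes "W_1_inf \<Omega> u Du" shows "W_1_inf \<Omega> (\<lambda>x. c * u x) (\<lambda>x. c *\<^sub>R Du x)"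
proof -
  obtain C where C: "AE x in lebesgue_on \<Omega>. \<bar>u x\<bar> \<le> C \<and> norm (Du x) \<le> C"
    using assms by (auto simp: W_1_inf_def)
  then have "AE x in lebesgue_on \<Omega>. \<bar>c * u x\<bar> \<le> \<bar>c\<bar> * C \<and> norm (c *\<^sub>R Du x) \<le> \<bar>c\<bar> * C"
    by eventually_elim (auto simp: abs_mult intro!: mult_left_mono)
  then show ?thesis
    using assms by (auto simp: W_1_inf_def weak_gradient_cmult)
qed

lemma W0_1_1_cmult:
  assumes "c \<noteq> 0" "W0_1_1 \<Omega> u Du" shows "W0_1_1 \<Omega> (\<lambda>x. c * u x) (\<lambda>x. c *\<^sub>R Du x)"
proof -
  let ?E = "\<lambda>u Du \<phi>. (LINT x|lebesgue_on \<Omega>. \<bar>u x - \<phi> x\<bar>) + (LINT x|lebesgue_on \<Omega>. norm (Du x - grad \<phi> x))"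
  obtain \<phi> where \<phi>: "\<And>j::nat. \<phi> j \<in> test_functions \<Omega>" and lim: "(\<lambda>j. ?E u Du (\<phi> j)) \<longlonglongrightarrow> 0"
    using assms(2) by (auto simp: W0_1_1_def)
  have "?E (\<lambda>x. c * u x) (\<lambda>x. c *\<^sub>R Du x) (\<lambda>x. c * \<phi> j x) = \<bar>c\<bar> * ?E u Du (\<phi> j)" for j
    by (simp add: grad_cmult[OF \<phi>] abs_mult distrib_left
        flip: right_diff_distrib scaleR_right_diff_distrib)
  moreover have "(\<lambda>j. \<bar>c\<bar> * ?E u Du (\<phi> j)) \<longlonglongrightarrow> 0"
    using tendsto_mult_left[OF lim, of "\<bar>c\<bar>"] by simp
  ultimately have "(\<lambda>j. ?E (\<lambda>x. c * u x) (\<lambda>x. c *\<^sub>R Du x) (\<lambda>x. c * \<phi> j x)) \<longlonglongrightarrow> 0"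
    by simp
  then have "\<exists>\<psi>. (\<forall>j. \<psi> j \<in> test_functions \<Omega>) \<and> (\<lambda>j. ?E (\<lambda>x. c * u x) (\<lambda>x. c *\<^sub>R Du x) (\<psi> j)) \<longlonglongrightarrow> 0"
    using test_functions_cmult[OF assms(1) \<phi>] by (intro exI[of _ "\<lambda>j x. c * \<phi> j x"]) auto
  then show ?thesis
    using assms(2) by (simp add: W0_1_1_def weak_gradient_cmult)
qed

lemma W0_1_inf_cmult:
  "c \<noteq> 0 \<Longrightarrow> W0_1_inf \<Omega> u Du \<Longrightarrow> W0_1_inf \<Omega> (\<lambda>x. c * u x) (\<lambda>x. c *\<^sub>R Du x)"
  by (simp add: W0_1_inf_def W_1_inf_cmult W0_1_1_cmult)

section \<open>Quasiconvexity\<close>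

lemma continuous_on_linear_form:
  fixes L :: "'a::euclidean_space \<Rightarrow> 'n::finite form"
  assumes "linear L" shows "continuous_on UNIV L"
proof (rule continuous_on_coordinatewise_then_product)
  show "continuous_on UNIV (\<lambda>x. L x vs)" for vs
    using linear_compose[OF assms linear_fun_eval[of vs]] by (simp add: linear_continuous_on linear_linear o_def)
qed

context row_numbering
begin

lemma continuous_lift: "continuous_on UNIV (lift k idx)"
  unfolding lift_def by (intro continuous_intros continuous_on_product_coordinates)

lemma borel_measurable_iff:
  "f \<in> borel_measurable (restrict_space borel (alt_forms k)) \<longleftrightarrow>
   f \<circ> (proj k :: real^'n::{finite,linorder}^'N::{finite,linorder} \<Rightarrow> _) \<in> borel_measurable borel"
proof
  have m: "(proj k :: real^'n::{finite,linorder}^'N::{finite,linorder} \<Rightarrow> _) \<in> borel \<rightarrow>\<^sub>M restrict_space borel (alt_forms k)"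
    using proj_alt continuous_on_linear_form[OF linear_proj]
    by (intro measurable_restrict_space2 borel_measurable_continuous_onI) auto
  show "f \<circ> (proj k :: real^'n::{finite,linorder}^'N::{finite,linorder} \<Rightarrow> _) \<in> borel_measurable borel"
    if "f \<in> borel_measurable (restrict_space borel (alt_forms k))"
    using m that by (rule measurable_comp)
next
  assume f: "f \<circ> (proj k :: real^'n::{finite,linorder}^'N::{finite,linorder} \<Rightarrow> _) \<in> borel_measurable borel"
  have "lift k idx \<in> restrict_space borel (alt_forms k) \<rightarrow>\<^sub>M borel"
    by (intro measurable_restrict_space1 borel_measurable_continuous_onI continuous_lift)
  from measurable_comp[OF this f]
  show "f \<in> borel_measurable (restrict_space borel (alt_forms k))"
    by (rule measurable_cong[THEN iffD1, rotated]) (simp add: space_restrict_space proj_lift)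
qed

lemma locally_bounded_iff:
  "locally_bounded_on (alt_forms k) f \<longleftrightarrow>
   locally_bounded_on UNIV (f \<circ> (proj k :: real^'n::{finite,linorder}^'N::{finite,linorder} \<Rightarrow> _))"
proof
  assume f: "locally_bounded_on (alt_forms k) f"
  show "locally_bounded_on UNIV (f \<circ> (proj k :: real^'n::{finite,linorder}^'N::{finite,linorder} \<Rightarrow> _))"
    unfolding locally_bounded_on_def
  proof
    fix X :: "real^'n::{finite,linorder}^'N::{finite,linorder}"
    let ?p = "proj k :: real^'n::{finite,linorder}^'N::{finite,linorder} \<Rightarrow> 'n form"
    obtain U where U: "open U" "proj k X \<in> U" "bounded (f ` (U \<inter> alt_forms k))"
      using f proj_alt[of X] unfolding locally_bounded_on_def by blast
    have "open (?p -` U)"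
      by (rule open_vimage[OF U(1) continuous_on_linear_form[OF linear_proj]])
    moreover have "(f \<circ> ?p) ` (?p -` U \<inter> UNIV) \<subseteq> f ` (U \<inter> alt_forms k)"
      using proj_alt by auto
    ultimately show "\<exists>V. open V \<and> X \<in> V \<and> bounded ((f \<circ> ?p) ` (V \<inter> UNIV))"
      using U(2,3) bounded_subset by (metis vimage_eq)
  qed
next
  let ?p = "proj k :: real^'n::{finite,linorder}^'N::{finite,linorder} \<Rightarrow> 'n form"
  assume f: "locally_bounded_on UNIV (f \<circ> ?p)"
  show "locally_bounded_on (alt_forms k) f"
    unfolding locally_bounded_on_def
  proof
    fix \<xi> :: "'n form" assume "\<xi> \<in> alt_forms k"
    obtain V where V: "open V" "lift k idx \<xi> \<in> V" "bounded ((f \<circ> ?p) ` (V \<inter> UNIV))"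
      using f unfolding locally_bounded_on_def by blast
    have "open (lift k idx -` V)"
      by (rule open_vimage[OF V(1) continuous_lift])
    moreover have "f ` (lift k idx -` V \<inter> alt_forms k) \<subseteq> (f \<circ> ?p) ` (V \<inter> UNIV)"
    proof safe
      fix \<eta> assume \<eta>: "lift k idx \<eta> \<in> V" "\<eta> \<in> alt_forms k"
      then have "f \<eta> = (f \<circ> ?p) (lift k idx \<eta>)" by (simp add: proj_lift)
      then show "f \<eta> \<in> (f \<circ> ?p) ` (V \<inter> UNIV)" using \<eta>(1) by blast
    qed
    ultimately show "\<exists>U. open U \<and> \<xi> \<in> U \<and> bounded (f ` (U \<inter> alt_forms k))"
      using V(2,3) bounded_subset by (metis vimage_eq)
  qed
qed

text \<open>A \<open>(k - 1)\<close>-form with coefficients in \<open>W\<^sub>0\<^sup>1\<^sup>,\<^sup>\<infinity>\<close> and a vector field \<open>u\<close> in that space determine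
  each other through \<open>u\<^sub>r = (-1)\<^bsup>k-1\<^esup> \<omega>\<^bsub>I\<^sub>r\<^esub>\<close>, and then the two integrands coincide.\<close>

theorem ext_quasiconvex_iff_quasiconvex:
  "ext_quasiconvex k f \<longleftrightarrow> quasiconvex (f \<circ> (proj k :: real^'n::{finite,linorder}^'N::{finite,linorder} \<Rightarrow> _))"
proof -
  let ?p = "proj k :: real^'n::{finite,linorder}^'N::{finite,linorder} \<Rightarrow> 'n form"
  define c :: real where "c = (-1) ^ (k - 1)"
  have c: "c \<noteq> 0" "c * c = 1" by (simp_all add: c_def flip: power_mult_distrib)
  have deriv: "ext_deriv (k - 1) Dw x = ?p (\<chi> r. c *\<^sub>R Dw (idx r) x)" for Dw and x :: "real^'n::{finite,linorder}"
    unfolding c_def by (rule ext_deriv_eq[OF idx bij])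
  show ?thesis
  proof
    assume f: "ext_quasiconvex k f"
    show "quasiconvex (f \<circ> ?p)"
      unfolding quasiconvex_def
    proof (intro conjI allI impI)
      fix \<Omega> :: "(real^'n::{finite,linorder}) set" and X :: "real^'n::{finite,linorder}^'N::{finite,linorder}" and u Du
      assume \<Omega>: "bounded \<Omega>" "open \<Omega>" and u: "W0_1_inf_vec \<Omega> u (Du :: _ \<Rightarrow> real^'n::{finite,linorder}^'N::{finite,linorder})"
      define \<omega> where "\<omega> x = (\<Sum>r\<in>UNIV. (c * u x $ r) *\<^sub>R flats (axes (idx r)))" for x
      define Dw where "Dw I x = c *\<^sub>R Du x $ (inv_into UNIV idx I)" for I x
      have inv: "inv_into UNIV idx (idx r) = r" for r
        using bij by (simp add: bij_betw_def)
      have w: "coeff_form (\<omega> x) (idx r) = c * u x $ r" for x r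
      proof -
        have "flats (axes (idx r')) (axes (idx r)) = of_bool (r' = r)" for r'
          using bij by (subst flats_axes_basis[of _ "k - 1"]) (auto simp: bij_betw_def inj_eq)
        then show ?thesis by (simp add: coeff_form_axes \<omega>_def sum_fun_apply)
      qed
      have "W0_1_inf_form (k - 1) \<Omega> \<omega> Dw"
        unfolding W0_1_inf_form_def
      proof (intro conjI ballI)
        show "\<omega> x \<in> alt_forms (k - 1)" for x
          unfolding \<omega>_def by (intro alt_forms_sum alt_forms_scale row_alt)
        fix I :: "'n list" assume "I \<in> multi_indices (k - 1)"
        then obtain r where I: "I = idx r" using bij by (auto simp: bij_betw_def)
        show "W0_1_inf \<Omega> (\<lambda>x. coeff_form (\<omega> x) I) (Dw I)"
          using W0_1_inf_cmult[OF c(1), of \<Omega> "\<lambda>x. u x $ r" "\<lambda>x. Du x $ r"] u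
          by (simp add: I w Dw_def[abs_def] inv W0_1_inf_vec_def)
      qed
      with \<Omega> f have "f (?p X) * measure lebesgue \<Omega> \<le> (LINT x|lebesgue_on \<Omega>. f (?p X + ext_deriv (k - 1) Dw x))"
        using proj_alt[of X] unfolding ext_quasiconvex_def by blast
      moreover have "ext_deriv (k - 1) Dw x = ?p (Du x)" for x
        unfolding deriv by (simp add: Dw_def inv c(2))
      ultimately show "(f \<circ> ?p) X * measure lebesgue \<Omega> \<le> (LINT x|lebesgue_on \<Omega>. (f \<circ> ?p) (X + Du x))"
        by (simp add: linear_add[OF linear_proj])
    qed (use f borel_measurable_iff locally_bounded_iff in \<open>auto simp: ext_quasiconvex_def\<close>)
  next
    assume f: "quasiconvex (f \<circ> ?p)"
    show "ext_quasiconvex k f"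
      unfolding ext_quasiconvex_def
    proof (intro conjI allI impI)
      fix \<Omega> :: "(real^'n::{finite,linorder}) set" and \<xi> :: "'n form" and \<omega> Dw
      assume \<Omega>: "bounded \<Omega>" "open \<Omega>" and \<xi>: "\<xi> \<in> alt_forms k" and w: "W0_1_inf_form (k - 1) \<Omega> \<omega> Dw"
      define u :: "_ \<Rightarrow> real^'N::{finite,linorder}" where "u x = (\<chi> r. c * coeff_form (\<omega> x) (idx r))" for x
      define Du :: "_ \<Rightarrow> real^'n::{finite,linorder}^'N::{finite,linorder}" where "Du x = (\<chi> r. c *\<^sub>R Dw (idx r) x)" for x
      have "W0_1_inf_vec \<Omega> u Du"
        unfolding W0_1_inf_vec_def
      proof
        fix r
        have "idx r \<in> multi_indices (k - 1)" using bij by (auto simp: bij_betw_def)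
        then have "W0_1_inf \<Omega> (\<lambda>x. coeff_form (\<omega> x) (idx r)) (Dw (idx r))"
          using w unfolding W0_1_inf_form_def by blast
        from W0_1_inf_cmult[OF c(1) this] show "W0_1_inf \<Omega> (\<lambda>x. u x $ r) (\<lambda>x. Du x $ r)"
          by (simp add: u_def Du_def)
      qed
      with \<Omega> f have "(f \<circ> ?p) (lift k idx \<xi>) * measure lebesgue \<Omega>
          \<le> (LINT x|lebesgue_on \<Omega>. (f \<circ> ?p) (lift k idx \<xi> + Du x))"
        unfolding quasiconvex_def by blast
      then show "f \<xi> * measure lebesgue \<Omega> \<le> (LINT x|lebesgue_on \<Omega>. f (\<xi> + ext_deriv (k - 1) Dw x))"
        unfolding deriv Du_def comp_def linear_add[OF linear_proj] proj_lift[OF \<xi>] .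
    qed (use f borel_measurable_iff locally_bounded_iff in \<open>auto simp: quasiconvex_def\<close>)
  qed
qed

end

section \<open>Polyconvexity of the composition\<close>

lemma convex_on_linear_compose:
  assumes "linear L" "convex S" "L ` S \<subseteq> T" "convex_on T G"
  shows "convex_on S (\<lambda>x. G (L x))"
  using assms by (auto simp: convex_on_def linear_add linear_scale image_subset_iff)

lemma subspace_family_product:
  assumes "\<And>s. subspace (V s)" shows "subspace (family_product m V)"
  using assms by (auto simp: subspace_def family_product_def)

lemma subspace_minor_space: "subspace (minor_space s)"
  by (auto simp: subspace_def minor_space_def)

lemma adj_in_minor_space: "adj X s \<in> minor_space s"
  by (auto simp: minor_space_def adj_def)

lemma family_in_product: "(\<And>s. X s \<in> V s) \<Longrightarrow> family m X \<in> family_product m V"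
  by (simp add: family_def family_product_def)

lemma linear_family:
  assumes "\<And>s. linear (L s)" shows "linear (\<lambda>A. family m (\<lambda>s. L s (A s)))"
  by (rule linearI) (auto simp: family_def fun_eq_iff linear_add[OF assms] linear_scale[OF assms])

lemma finite_length_eq [simp]: "finite {R :: 'a::finite list. length R = s}"
  using finite_lists_length_eq[of "UNIV :: 'a set" s] by simp

text \<open>Sums over all \<open>s\<close>-tuples, repetitions included, are written as sums over lists of length \<open>s\<close>.\<close>

lemma sum_length_Suc:
  fixes g :: "'a::finite list \<Rightarrow> 'b::comm_monoid_add"
  shows "(\<Sum>R | length R = Suc s. g R) = (\<Sum>r\<in>UNIV. \<Sum>R | length R = s. g (r # R))"
proof -
  have "(\<Sum>R | length R = Suc s. g R) = (\<Sum>(r, R)\<in>UNIV \<times> {R. length R = s}. g (r # R))"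
    by (rule sum.reindex_bij_witness[of _ "\<lambda>(r, R). r # R" "\<lambda>R. (hd R, tl R)"])
      (auto simp: length_Suc_conv)
  then show ?thesis by (simp add: sum.cartesian_product)
qed

text \<open>The linear map that turns the minors of order \<open>s\<close> into \<open>(\<pi> X)\<^sup>s\<close>. The factor
  \<open>flats (axes I) (axes R)\<close> is the sign of the permutation that sorts the tuple \<open>R\<close> to \<open>I\<close>, and zero if
  there is none.\<close>

definition minors_to_form ::
    "('N \<Rightarrow> 'n::{finite,linorder} list) \<Rightarrow> nat \<Rightarrow> ('N::{finite,linorder} list \<Rightarrow> 'n list \<Rightarrow> real) \<Rightarrow> 'n form" where
  "minors_to_form idx s A = (\<Sum>R | length R = s. \<Sum>J\<in>multi_indices s. \<Sum>I\<in>multi_indices s.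
     (A I J * flats (axes I) (axes R)) *\<^sub>R wprod (map (\<lambda>r. flats (axes (idx r))) R) (axes J))"

lemma linear_minors_to_form: "linear (minors_to_form idx s)"
  by (rule linearI)
    (simp_all add: minors_to_form_def algebra_simps sum.distrib scaleR_sum_right)

context row_numbering
begin

lemma wprod_alt:
  "length ws = length R \<Longrightarrow> wprod (map (\<lambda>r. flats (axes (idx r))) R) ws \<in> alt_forms (length R * k)"
proof (induction ws R rule: list_induct2)
  case (Cons w ws r R)
  have "k - 1 + (1 + length R * k) = length (r # R) * k" using k by simp
  then show ?case
    using wedge_alt[OF row_alt[of r] wedge_alt[OF flat_alt[of w] Cons.IH]] by simp
qed auto

lemma minors_to_form_alt: "minors_to_form idx s A \<in> alt_forms (s * k)"
  unfolding minors_to_form_def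
proof (intro alt_forms_sum alt_forms_scale)
  fix R :: "'N list" and J :: "'n list"
  assume "R \<in> {R. length R = s}" "J \<in> multi_indices s"
  then show "wprod (map (\<lambda>r. flats (axes (idx r))) R) (axes J) \<in> alt_forms (s * k)"
    using wprod_alt[of "axes J" R] by (auto simp: length_multi_index)
qed

lemma wedge_power_proj_wprod:
  fixes X :: "real^'n::{finite,linorder}^'N::{finite,linorder}"
  shows "wedge_power (proj k X) s
    = (\<Sum>R | length R = s. wprod (map (\<lambda>r. flats (axes (idx r))) R) (map (($) X) R))"
proof (induction s)
  case (Suc s)
  show ?case
    by (simp add: Suc sum_length_Suc)
      (simp add: proj_eq idx linear_sum[OF linear_wedge_left] linear_sum[OF linear_wedge_right] wedge_assoc
        sum.swap[of _ UNIV])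
qed simp

text \<open>Each summand over a tuple \<open>R\<close> of rows is an alternating form evaluated at these rows. Expand it
  in basis forms; their values at rows of \<open>X\<close> are minors up to the order of the rows.\<close>

lemma wedge_power_proj:
  fixes X :: "real^'n::{finite,linorder}^'N::{finite,linorder}"
  shows "wedge_power (proj k X) s = minors_to_form idx s (adj X s)"
proof
  fix vs
  have "wprod (map (\<lambda>r. flats (axes (idx r))) R) (map (($) X) R) vs
    = (\<Sum>J\<in>multi_indices s. \<Sum>I\<in>multi_indices s.
     (adj X s I J * flats (axes I) (axes R)) * wprod (map (\<lambda>r. flats (axes (idx r))) R) (axes J) vs)"
    if R: "length R = s" for R
  proof -
    let ?\<tau> = "\<lambda>ws. wprod (map (\<lambda>r. flats (axes (idx r))) R) ws vs"
    have \<tau>: "?\<tau> \<in> alt_forms s"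
      using wprod_alternating[of "map (\<lambda>r. flats (axes (idx r))) R" vs] R by simp
    have "flats (axes J) (map (($) X) R) = (\<Sum>I\<in>multi_indices s. adj X s I J * flats (axes I) (axes R))"
      if J: "J \<in> multi_indices s" for J
    proof -
      have "pullback X (flats (axes J)) \<in> alt_forms s"
        using J by (intro pullback_alt flats_alt') (simp add: length_multi_index)
      from fun_cong[OF basis_expansion_alt[OF this], of "axes R"]
      show ?thesis using J by (simp add: sum_fun_apply adj_eq_pullback pullback_axes)
    qed
    then show ?thesis
      using fun_cong[OF basis_expansion_alt[OF \<tau>], of "map (($) X) R"]
      by (simp add: sum_fun_apply sum_distrib_left mult_ac)
  qed
  then show "wedge_power (proj k X) s vs = minors_to_form idx s (adj X s) vs"
    by (simp add: wedge_power_proj_wprod minors_to_form_def sum_fun_apply)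
qed

text \<open>The hypothesis on the dimensions says that minors of all orders up to the highest power of \<open>\<xi>\<close>
  are available.\<close>

theorem polyconvex_if_ext_polyconvex:
  assumes "CARD('n) div k \<le> min CARD('N) CARD('n)" and f: "ext_polyconvex k f"
  shows "polyconvex (f \<circ> (proj k :: real^'n::{finite,linorder}^'N::{finite,linorder} \<Rightarrow> _))"
proof -
  let ?m = "CARD('n) div k" and ?M = "min CARD('N) CARD('n)"
  let ?p = "proj k :: real^'n::{finite,linorder}^'N::{finite,linorder} \<Rightarrow> 'n form"
  obtain F where F: "convex_on (family_product ?m (\<lambda>s. alt_forms (s * k))) F"
    and fF: "\<And>\<xi>. \<xi> \<in> alt_forms k \<Longrightarrow> f \<xi> = F (family ?m (wedge_power \<xi>))"
    using f by (auto simp: ext_polyconvex_def)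
  let ?L = "\<lambda>A. family ?m (\<lambda>s. minors_to_form idx s (A s))"
  have "convex_on (family_product ?M minor_space) (\<lambda>A. F (?L A))"
  proof (rule convex_on_linear_compose[OF _ _ _ F])
    show "linear ?L" by (intro linear_family linear_minors_to_form)
    show "convex (family_product ?M (minor_space :: _ \<Rightarrow> ('N list \<Rightarrow> 'n list \<Rightarrow> real) set))"
      by (intro subspace_imp_convex subspace_family_product subspace_minor_space)
    show "?L ` family_product ?M minor_space \<subseteq> family_product ?m (\<lambda>s. alt_forms (s * k))"
      by (intro image_subsetI family_in_product minors_to_form_alt)
  qed
  moreover have "(f \<circ> ?p) X = F (?L (family ?M (adj X)))" for X
  proof -
    have "s \<le> CARD('N)" "s \<le> CARD('n)" if "s \<le> ?m" for s
      using that assms(1) by linarith+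
    then have "?L (family ?M (adj X)) = family ?m (wedge_power (?p X))"
      by (auto simp: family_def wedge_power_proj fun_eq_iff)
    then show ?thesis using fF[OF proj_alt[of X]] by simp
  qed
  ultimately show ?thesis unfolding polyconvex_def by blast
qed

end

section \<open>Directions of invariance of a convex function\<close>

text \<open>If \<open>g s < g t\<close>, convexity forces linear growth beyond \<open>t\<close>, seen from \<open>s\<close>.\<close>

lemma convex_bounded_above_constant:
  fixes g :: "real \<Rightarrow> real"
  assumes g: "convex_on UNIV g" and C: "\<And>t. g t \<le> C"
  shows "g t = g s"
proof -
  have le: "g t \<le> g s" for s t
  proof (rule ccontr)
    assume "\<not> g t \<le> g s"
    then have pos: "g t - g s > 0" by simp
    \<comment> \<open>With this \<open>l\<close> the quantity \<open>l * (g t - g s)\<close> exceeds \<open>C - g s\<close> by exactly \<open>g t - g s\<close>.\<close>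
    define l where "l = 1 + (C - g s) / (g t - g s)"
    have "C - g s > 0" using C[of t] pos by simp
    then have l: "l > 1" using pos by (simp add: l_def)
    have "t = (1 - 1 / l) * s + (1 / l) * (s + l * (t - s))" using l by (simp add: field_simps)
    then have "g t \<le> (1 - 1 / l) * g s + (1 / l) * g (s + l * (t - s))"
      using convex_onD[OF g, of "1 / l" s "s + l * (t - s)"] l by simp
    also have "\<dots> \<le> (1 - 1 / l) * g s + (1 / l) * C"
      using C l by (intro add_left_mono mult_left_mono) auto
    finally have "l * (g t - g s) \<le> C - g s" using l by (simp add: field_simps)
    moreover have "l * (g t - g s) = (g t - g s) + (C - g s)" using pos by (simp add: l_def field_simps)
    ultimately show False using pos by simp
  qed
  from le[of t s] le[of s t] show ?thesis by simp
qed

definition invariant_directions :: "'a::real_vector set \<Rightarrow> ('a \<Rightarrow> real) \<Rightarrow> 'a set" where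
  "invariant_directions T G = {u \<in> T. \<forall>A\<in>T. \<forall>t. G (A + t *\<^sub>R u) = G A}"

lemma subspace_invariant_directions:
  assumes T: "subspace T" shows "subspace (invariant_directions T G)"
proof (rule subspaceI)
  show "0 \<in> invariant_directions T G" using subspace_0[OF T] by (simp add: invariant_directions_def)
  fix u assume u: "u \<in> invariant_directions T G"
  show "c *\<^sub>R u \<in> invariant_directions T G" for c
    using u subspace_scale[OF T] by (auto simp: invariant_directions_def)
  fix v assume v: "v \<in> invariant_directions T G"
  have "G (A + t *\<^sub>R (u + v)) = G A" if A: "A \<in> T" for A t
  proof -
    have "A + t *\<^sub>R u \<in> T" using A u subspace_add[OF T] subspace_scale[OF T] by (auto simp: invariant_directions_def)
    then have "G ((A + t *\<^sub>R u) + t *\<^sub>R v) = G (A + t *\<^sub>R u)" using v by (simp add: invariant_directions_def)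
    then show ?thesis using u A by (simp add: invariant_directions_def scaleR_add_right add.assoc)
  qed
  then show "u + v \<in> invariant_directions T G"
    using u v subspace_add[OF T] by (simp add: invariant_directions_def)
qed

text \<open>The point \<open>A + t u\<close> is the midpoint of the fixed point \<open>2 A - B\<close> and of \<open>B + 2 t u\<close>, which lies on
  the line where \<open>G\<close> is constant. So \<open>G\<close> is bounded above on the line through \<open>A\<close>, hence constant.
  This is where finiteness of \<open>G\<close> on the whole space is used.\<close>

lemma invariant_direction_if_constant_on_line:
  assumes T: "subspace T" and G: "convex_on T G" and B: "B \<in> T" and u: "u \<in> T"
    and const: "\<And>t. G (B + t *\<^sub>R u) = G B"
  shows "u \<in> invariant_directions T G"
proof -
  have "G (A + t *\<^sub>R u) = G A" if A: "A \<in> T" for A t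
  proof -
    let ?g = "\<lambda>t. G (A + t *\<^sub>R u)"
    have mem: "A' + t *\<^sub>R u \<in> T" if "A' \<in> T" for A' t
      using that u by (intro subspace_add[OF T] subspace_scale[OF T])
    have "convex_on UNIV ?g"
    proof (rule convex_onI)
      fix \<theta> x y :: real assume "0 < \<theta>" "\<theta> < 1"
      moreover have "A + ((1 - \<theta>) *\<^sub>R x + \<theta> *\<^sub>R y) *\<^sub>R u = (1 - \<theta>) *\<^sub>R (A + x *\<^sub>R u) + \<theta> *\<^sub>R (A + y *\<^sub>R u)"
        by (simp add: algebra_simps)
      ultimately show "?g ((1 - \<theta>) *\<^sub>R x + \<theta> *\<^sub>R y) \<le> (1 - \<theta>) * ?g x + \<theta> * ?g y"
        using convex_onD[OF G, of \<theta> "A + x *\<^sub>R u" "A + y *\<^sub>R u"] mem[OF A] by simp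
    qed simp
    moreover have "?g t \<le> 1 / 2 * G (2 *\<^sub>R A - B) + 1 / 2 * G B" for t
    proof -
      have "2 *\<^sub>R A - B \<in> T" using A B by (intro subspace_diff[OF T] subspace_scale[OF T])
      moreover have "A + t *\<^sub>R u = (1 - 1 / 2) *\<^sub>R (2 *\<^sub>R A - B) + (1 / 2) *\<^sub>R (B + (2 * t) *\<^sub>R u)"
        by (simp add: algebra_simps)
      ultimately show ?thesis
        using convex_onD[OF G, of "1 / 2" "2 *\<^sub>R A - B" "B + (2 * t) *\<^sub>R u"] mem[OF B] const by simp
    qed
    ultimately have "?g t = ?g 0" by (rule convex_bounded_above_constant)
    then show ?thesis by simp
  qed
  then show ?thesis using u by (simp add: invariant_directions_def)
qed

text \<open>For \<open>p\<close> of degree \<open>m\<close> the combination \<open>p (2 c) - 2\<^sup>m p (c)\<close> eliminates the highest coefficient and multiplies the others by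
  nonzero numbers, so induction applies.\<close>

lemma polynomial_coefficients_in_subspace:
  fixes D :: "nat \<Rightarrow> 'a::real_vector"
  assumes U: "subspace U" and "\<And>c::real. (\<Sum>s\<le>m. c ^ s *\<^sub>R D s) \<in> U" and "s \<le> m"
  shows "D s \<in> U"
  using assms(2,3)
proof (induction m arbitrary: D s)
  case 0
  from 0(1)[of 1] 0(2) show ?case by simp
next
  case (Suc m)
  let ?p = "\<lambda>c::real. \<Sum>s\<le>Suc m. c ^ s *\<^sub>R D s"
  have "(\<Sum>s\<le>m. c ^ s *\<^sub>R ((2 ^ s - 2 ^ Suc m) *\<^sub>R D s)) \<in> U" for c :: real
  proof -
    have "?p (2 * c) - 2 ^ Suc m *\<^sub>R ?p c \<in> U"
      by (intro subspace_diff[OF U] subspace_scale[OF U] Suc.prems(1))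
    moreover have "?p (2 * c) - 2 ^ Suc m *\<^sub>R ?p c = (\<Sum>s\<le>m. c ^ s *\<^sub>R ((2 ^ s - 2 ^ Suc m) *\<^sub>R D s))"
      by (simp add: scaleR_sum_right sum_subtractf[symmetric] power_mult_distrib algebra_simps)
    ultimately show ?thesis by simp
  qed
  then have "(2 ^ s - 2 ^ Suc m) *\<^sub>R D s \<in> U" if "s \<le> m" for s
    using that by (rule Suc.IH)
  then have *: "D s \<in> U" if "s \<le> m" for s
  proof -
    have "(2::real) ^ s - 2 ^ Suc m \<noteq> 0"
      using power_strict_increasing[of s "Suc m" "2::real"] that by simp
    then show ?thesis
      using subspace_scale[OF U \<open>s \<le> m \<Longrightarrow> _\<close>[OF that], of "inverse (2 ^ s - 2 ^ Suc m)"] by simp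
  qed
  have "(\<Sum>s\<le>m. D s) \<in> U" using * by (intro subspace_sum[OF U]) auto
  from subspace_diff[OF U Suc.prems(1)[of 1] this] have "D (Suc m) \<in> U" by simp
  with * Suc.prems(2) show ?case by (cases "s = Suc m") auto
qed

text \<open>Equality modulo \<open>U\<close> becomes equality of the images under a linear map with kernel \<open>U\<close>.\<close>

lemma projection_off_subspace:
  fixes U :: "'a::real_vector set"
  assumes U: "subspace U"
  shows "\<exists>P :: 'a \<Rightarrow> 'a. linear P \<and> (\<forall>u. P u = 0 \<longleftrightarrow> u \<in> U)"
proof -
  obtain g :: "'a \<Rightarrow> 'a" where g: "range g \<subseteq> U" "linear g" "\<And>u. u \<in> U \<Longrightarrow> g u = u"
    using linear_exists_left_inverse_on[OF linear_id U] by auto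
  have "linear (\<lambda>x. x - g x)" using linear_compose_sub[OF linear_id g(2)] by simp
  moreover have "u - g u = 0 \<longleftrightarrow> u \<in> U" for u using g(1) g(3)[of u] by (metis range_subsetD right_minus_eq)
  ultimately show ?thesis by blast
qed

section \<open>Elementary minors\<close>

text \<open>The minors of order \<open>s\<close> of a sum of \<open>s\<close> rank-one matrices, as a function of the \<open>2 s\<close> vectors; in
  this form they are visibly multilinear, and alternating in either group of vectors.\<close>

definition elementary_minors ::
    "nat \<Rightarrow> (real^'N::{finite,linorder}) list \<Rightarrow> (real^'n::{finite,linorder}) list \<Rightarrow> 'N::{finite,linorder} list \<Rightarrow> 'n::{finite,linorder} list \<Rightarrow> real" where
  "elementary_minors s as bs I J = (if I \<in> multi_indices s \<and> J \<in> multi_indices s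
     then flats as (axes I) * flats bs (axes J) else 0)"

lemma elementary_in_minor_space: "elementary_minors s as bs \<in> minor_space s"
  by (auto simp: minor_space_def elementary_minors_def)

lemma adj_outers:
  assumes "length as = s" "length bs = s"
  shows "adj (outers as bs) s = elementary_minors s as bs"
proof (intro ext)
  fix I J
  show "adj (outers as bs) s I J = elementary_minors s as bs I J"
  proof (cases "I \<in> multi_indices s \<and> J \<in> multi_indices s")
    case True
    then have "flats (axes J) \<in> alt_forms (length bs)"
      using assms by (intro flats_alt') (simp add: length_multi_index)
    from pullback_outers[OF _ this, of as] show ?thesis
      using True assms by (simp add: adj_eq_pullback elementary_minors_def flats_axes_sym[of J s])
  qed (auto simp: adj_off elementary_minors_def)
qed

lemma adj_outers_few:
  assumes "length as = length bs" "length bs < s"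
  shows "adj (outers as bs) s = 0"
proof (intro ext)
  fix I J
  show "adj (outers as bs) s I J = 0 I J"
  proof (cases "I \<in> multi_indices s \<and> J \<in> multi_indices s")
    case True
    then have "flats (axes J) \<in> alt_forms s"
      by (intro flats_alt') (simp add: length_multi_index)
    from pullback_outers_few[OF assms this] show ?thesis
      using True by (simp add: adj_eq_pullback)
  qed (auto simp: adj_off)
qed

lemma outers_insert:
  "length as = length bs \<Longrightarrow> outers (as @ a # as') (bs @ b # bs') = outers (as @ as') (bs @ bs') + outer a b"
  by (simp add: outers_def)

lemma adj_affine:
  "adj (Y + outer (t *\<^sub>R a) b) s = adj Y s + t *\<^sub>R (adj (Y + outer a b) s - adj Y s)"
proof (intro ext)
  fix I J
  show "adj (Y + outer (t *\<^sub>R a) b) s I J = (adj Y s + t *\<^sub>R (adj (Y + outer a b) s - adj Y s)) I J"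
  proof (cases "I \<in> multi_indices s \<and> J \<in> multi_indices s")
    case True
    then have J: "flats (axes J) \<in> alt_forms s"
      by (intro flats_alt') (simp add: length_multi_index)
    show ?thesis using True
      by (simp add: adj_eq_pullback pullback_rank_one[OF J] linear_scale[OF linear_flat] wedge_scale_left)
  qed (auto simp: adj_off)
qed

lemma pullback_scale_matrix:
  "\<theta> \<in> alt_forms p \<Longrightarrow> pullback (c *\<^sub>R X) \<theta> ws = c ^ length ws * pullback X \<theta> ws"
proof (induction ws arbitrary: \<theta> p)
  case (Cons w ws)
  have "pullback (c *\<^sub>R X) \<theta> (w # ws) = c * pullback (c *\<^sub>R X) (iota (row_comb X w) \<theta>) ws"
    using iota_scale[OF Cons.prems] by (simp add: pullback_Cons linear_scale[OF row_comb_linear_mat])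
  also have "\<dots> = c * (c ^ length ws * pullback X (iota (row_comb X w) \<theta>) ws)"
    unfolding Cons.IH[OF iota_alt_pred[OF Cons.prems]] ..
  finally show ?case by (simp add: pullback_Cons)
qed simp

lemma adj_scale: "adj (c *\<^sub>R X) s = c ^ s *\<^sub>R adj X s"
proof (intro ext)
  fix I J
  show "adj (c *\<^sub>R X) s I J = (c ^ s *\<^sub>R adj X s) I J"
  proof (cases "I \<in> multi_indices s \<and> J \<in> multi_indices s")
    case True
    then have J: "flats (axes J) \<in> alt_forms s"
      by (intro flats_alt') (simp add: length_multi_index)
    show ?thesis using True
      by (simp add: adj_eq_pullback pullback_scale_matrix[OF J] length_multi_index[of I s])
  qed (auto simp: adj_off)
qed

lemma linear_elementary_left: "linear (\<lambda>a. elementary_minors s (as @ a # as') bs)"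
  by (rule linearI)
    (auto simp: elementary_minors_def fun_eq_iff flats_append linear_add[OF linear_flat] linear_scale[OF linear_flat]
      wedge_add_left wedge_add_right wedge_scale_left wedge_scale_right algebra_simps)

lemma linear_elementary_right: "linear (\<lambda>b. elementary_minors s as (bs @ b # bs'))"
  by (rule linearI)
    (auto simp: elementary_minors_def fun_eq_iff flats_append linear_add[OF linear_flat] linear_scale[OF linear_flat]
      wedge_add_left wedge_add_right wedge_scale_left wedge_scale_right algebra_simps)

lemma flats_swap: "flats (us @ v # w # vs) = - flats (us @ w # v # vs)"
proof -
  have "flat v \<and>\<^sub>w flat w \<and>\<^sub>w flats vs = (flat v \<and>\<^sub>w flat w) \<and>\<^sub>w flats vs" by (simp add: wedge_assoc)
  also have "\<dots> = - (flat w \<and>\<^sub>w flat v \<and>\<^sub>w flats vs)"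
    by (simp add: flat_wedge_commute[of v "flat w"] wedge_assoc)
  finally show ?thesis by (simp add: flats_append)
qed

lemma elementary_swap_right:
  "elementary_minors s as (bs @ b # c # bs') = - elementary_minors s as (bs @ c # b # bs')"
  by (auto simp: elementary_minors_def fun_eq_iff flats_swap[of bs b c])

text \<open>The inclusion of the component of order \<open>s\<close> into the product of all orders.\<close>

definition single :: "nat \<Rightarrow> 'a \<Rightarrow> nat \<Rightarrow> 'a::zero" where
  "single s A = (\<lambda>s'. if s' = s then A else 0)"

lemma linear_single: "linear (single s)"
  by (rule linearI) (auto simp: single_def fun_eq_iff)

lemma family_eq_sum_single: "family m X = (\<Sum>s\<in>{1..m}. single s (X s))"
  by (rule ext) (simp add: sum_fun_apply single_def family_def)

section \<open>Alternation of concatenated arguments\<close>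

text \<open>Beyond alternation in each of the two groups of arguments, only the case of equal neighbours
  across the boundary has to be checked, because adjacent transpositions generate all
  permutations.\<close>

lemma alt_forms_appendI:
  assumes "\<And>vs. length vs \<noteq> p + q \<Longrightarrow> h vs = 0"
    and "\<And>ws. length ws = q \<Longrightarrow> (\<lambda>us. h (us @ ws)) \<in> alt_forms p"
    and "\<And>us. length us = p \<Longrightarrow> (\<lambda>ws. h (us @ ws)) \<in> alt_forms q"
    and "\<And>us v ws. Suc (length us) = p \<Longrightarrow> Suc (length ws) = q \<Longrightarrow> h (us @ v # v # ws) = 0"
  shows "h \<in> alt_forms (p + q)"
  using assms
proof (induction p arbitrary: h)
  case 0
  from 0(3)[of "[]"] show ?case by simp
next
  case (Suc p)
  note len = Suc.prems(1) and left = Suc.prems(2) and right = Suc.prems(3) and mid = Suc.prems(4)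
  have "iota v h \<in> alt_forms (p + q)" for v
  proof (rule Suc.IH)
    show "iota v h vs = 0" if "length vs \<noteq> p + q" for vs using that len by (simp add: iota_def)
    show "(\<lambda>us. iota v h (us @ ws)) \<in> alt_forms p" if "length ws = q" for ws
      using iota_alt[OF left[OF that], of v] by (simp add: iota_def)
    show "(\<lambda>ws. iota v h (us @ ws)) \<in> alt_forms q" if "length us = p" for us
      using right[of "v # us"] that by (simp add: iota_def)
    show "iota v h (us @ w # w # ws) = 0" if "Suc (length us) = p" "Suc (length ws) = q" for us w ws
      using mid[of "v # us" ws w] that by (simp add: iota_def)
  qed
  moreover have "h [] = 0" using len by simp
  moreover have "linear (\<lambda>v. h (v # vs))" for vs
  proof (cases "length vs = p + q")
    case True
    then have "linear (\<lambda>v. h ((v # take p vs) @ drop p vs))"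
      using linear_Cons[OF left[of "drop p vs"], of "take p vs"] by simp
    then show ?thesis by simp
  next
    case False then show ?thesis using len linear_zero by simp
  qed
  moreover have "h (v # v # vs) = 0" for v vs
  proof (cases "Suc (length vs) = p + q")
    case True
    show ?thesis
    proof (cases p)
      case 0 then show ?thesis using mid[of "[]" vs v] True by simp
    next
      case (Suc p')
      then have "(\<lambda>us. h (us @ drop p' vs)) \<in> alt_forms (Suc p)" using True by (intro left) simp
      then have "h ((v # v # take p' vs) @ drop p' vs) = 0" unfolding alt_forms_Suc by blast
      then show ?thesis by simp
    qed
  next
    case False then show ?thesis using len by simp
  qed
  ultimately show ?case by (simp add: alt_forms_Suc)
qed

lemma alt_forms_1I:
  assumes "linear l" shows "(\<lambda>us. case us of [b] \<Rightarrow> l b | _ \<Rightarrow> 0) \<in> alt_forms 1"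
  unfolding One_nat_def alt_forms_Suc
proof (intro conjI allI)
  show "iota v (\<lambda>us. case us of [b] \<Rightarrow> l b | _ \<Rightarrow> 0) \<in> alt_forms 0" for v
    by (auto simp: alt_forms_def iota_def split: list.splits)
  show "linear (\<lambda>v. case v # vs of [b] \<Rightarrow> l b | _ \<Rightarrow> 0)" for vs
    using assms linear_zero by (cases vs) auto
qed auto

text \<open>This peels the first block of \<open>k\<close> vectors off a pairing with a wedge power.\<close>

lemma pairing_wedge:
  fixes q \<zeta> :: "'n::{finite,linorder} form"
  assumes q: "q \<in> alt_forms (k + m)" and \<zeta>: "\<zeta> \<in> alt_forms m" and us: "length us = k"
  shows "(\<Sum>L\<in>multi_indices (k + m). q (axes L) * (flats us \<and>\<^sub>w \<zeta>) (axes L))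
       = (\<Sum>L\<in>multi_indices m. q (us @ axes L) * \<zeta> (axes L))"
proof -
  have "flats us \<and>\<^sub>w \<zeta> = (\<Sum>L'\<in>multi_indices m. \<zeta> (axes L') *\<^sub>R flats (us @ axes L'))"
    by (subst basis_expansion_alt[OF \<zeta>])
      (simp add: linear_sum[OF linear_wedge_right] wedge_scale_right flats_append)
  then have "(\<Sum>L\<in>multi_indices (k + m). q (axes L) * (flats us \<and>\<^sub>w \<zeta>) (axes L))
    = (\<Sum>L'\<in>multi_indices m. \<zeta> (axes L') * (\<Sum>L\<in>multi_indices (k + m). q (axes L) * flats (us @ axes L') (axes L)))"
    by (simp add: sum_fun_apply sum_distrib_left mult_ac sum.swap[of _ "multi_indices m"])
  then show ?thesis by (simp add: pairing_flats[OF q] mult.commute)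
qed

section \<open>Minors modulo the kernel of the projection\<close>

context row_numbering
begin

text \<open>A list of \<open>k\<close> vectors encodes the rank-one matrix whose column vector lists the coefficients of the
  product of the first \<open>k - 1\<close> and whose row is the last; \<open>\<pi>\<close> maps it to the product of all \<open>k\<close>.
  Longer lists are cut into blocks of length \<open>k\<close>.\<close>

definition block_row :: "(real^'n::{finite,linorder}) list \<Rightarrow> real^'N::{finite,linorder}" where
  "block_row us = row_coeffs idx (flats (butlast us))"

primrec block_rows :: "nat \<Rightarrow> (real^'n::{finite,linorder}) list \<Rightarrow> (real^'N::{finite,linorder}) list" where
  "block_rows 0 vs = []"
| "block_rows (Suc t) vs = block_row (take k vs) # block_rows t (drop k vs)"

primrec block_columns :: "nat \<Rightarrow> (real^'n::{finite,linorder}) list \<Rightarrow> (real^'n::{finite,linorder}) list" where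
  "block_columns 0 vs = []"
| "block_columns (Suc t) vs = last (take k vs) # block_columns t (drop k vs)"

lemma length_blocks [simp]: "length (block_rows t vs) = t" "length (block_columns t vs) = t"
  by (induction t arbitrary: vs) auto

lemma proj_block: "length us = k \<Longrightarrow> proj k (outer (block_row us) (last us)) = flats us"
proof -
  assume us: "length us = k"
  then obtain vs v where [simp]: "us = vs @ [v]" using k by (cases us rule: rev_cases) auto
  have "flats vs \<in> alt_forms (k - 1)" using us by (intro flats_alt') simp
  from proj_outer_coeffs[OF this, of v] show ?thesis by (simp add: block_row_def flats_append)
qed

text \<open>These functionals stand for the components of a linear map that vanishes on the subspace \<open>U\<close> of
  directions of invariance.\<close>

definition kernel_blind :: "nat \<Rightarrow> (('N list \<Rightarrow> 'n list \<Rightarrow> real) \<Rightarrow> real) \<Rightarrow> bool" where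
  "kernel_blind s c \<longleftrightarrow> linear c \<and> (\<forall>as as' bs bs' a b. length as = length bs \<longrightarrow> length as' = length bs' \<longrightarrow>
     Suc (length bs + length bs') = s \<longrightarrow> proj k (outer a b) = 0 \<longrightarrow>
     c (elementary_minors s (as @ a # as') (bs @ b # bs')) = 0)"

lemma kernel_blindD:
  "kernel_blind s c \<Longrightarrow> length as = length bs \<Longrightarrow> length as' = length bs' \<Longrightarrow> Suc (length bs + length bs') = s \<Longrightarrow>
   proj k (outer a b) = 0 \<Longrightarrow> c (elementary_minors s (as @ a # as') (bs @ b # bs')) = 0"
  by (simp add: kernel_blind_def)

text \<open>The first blocks are held fixed and given directly by \<open>as\<close> and \<open>bs\<close>; the remaining \<open>t\<close> blocks are the
  arguments. The fixed prefix makes the induction on \<open>t\<close> possible.\<close>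

definition block_form ::
    "(('N list \<Rightarrow> 'n list \<Rightarrow> real) \<Rightarrow> real) \<Rightarrow> nat \<Rightarrow> (real^'N::{finite,linorder}) list \<Rightarrow> (real^'n::{finite,linorder}) list \<Rightarrow> nat \<Rightarrow> 'n form" where
  "block_form c s as bs t vs = (if length vs = t * k
     then c (elementary_minors s (as @ block_rows t vs) (bs @ block_columns t vs)) else 0)"

text \<open>Within one block, alternation in the first \<open>k - 1\<close> vectors comes from the wedge product. If the last
  two vectors are equal, the block matrix lies in the kernel of \<open>\<pi>\<close>.\<close>

lemma one_block_alt:
  assumes c: "kernel_blind s c" and len: "length as = length bs" "length as' = length bs'" "Suc (length bs + length bs') = s"
  shows "(\<lambda>us. if length us = k
    then c (elementary_minors s (as @ block_row us # as') (bs @ last us # bs')) else 0) \<in> alt_forms k"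
    (is "?h \<in> _")
proof -
  have lin: "linear c" using c by (simp add: kernel_blind_def)
  have "?h \<in> alt_forms ((k - 1) + 1)"
  proof (rule alt_forms_appendI)
    show "?h vs = 0" if "length vs \<noteq> k - 1 + 1" for vs using that k by simp
    show "(\<lambda>us. ?h (us @ ws)) \<in> alt_forms (k - 1)" if "length ws = 1" for ws
    proof -
      obtain b where [simp]: "ws = [b]" using \<open>length ws = 1\<close> by (auto simp: length_Suc_conv)
      define l where "l = (\<lambda>a. c (elementary_minors s (as @ a # as') (bs @ b # bs')))"
      have l: "linear l" unfolding l_def
        using linear_compose[OF linear_elementary_left lin] by (simp add: o_def)
      have "l (row_coeffs idx \<alpha>) = (\<Sum>r\<in>UNIV. l (axis r 1) * \<alpha> (axes (idx r)))" for \<alpha>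
      proof -
        have "row_coeffs idx \<alpha> = (\<Sum>r\<in>UNIV. \<alpha> (axes (idx r)) *\<^sub>R axis r 1)"
          using basis_expansion[of "row_coeffs idx \<alpha>"] by (simp add: row_coeffs_def flip: scalar_mult_eq_scaleR)
        then show ?thesis by (simp add: linear_sum[OF l] linear_scale[OF l] mult.commute)
      qed
      moreover have "flats us (axes (idx r)) = 0" if "length us \<noteq> k - 1" for us r
        using that bij_betw_apply[OF bij, of r] alt_forms_length[OF flats_alt[of us]]
        by (auto simp: length_multi_index)
      ultimately have "(\<lambda>us. ?h (us @ ws)) = (\<Sum>r\<in>UNIV. l (axis r 1) *\<^sub>R (\<lambda>us. flats us (axes (idx r))))"
        using k by (auto simp: fun_eq_iff sum_fun_apply block_row_def l_def)
      moreover have "\<dots> \<in> alt_forms (k - 1)"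
        using bij_betw_apply[OF bij]
        by (intro alt_forms_sum alt_forms_scale flats_alternating') (simp add: length_multi_index)
      ultimately show ?thesis by simp
    qed
    show "(\<lambda>ws. ?h (us @ ws)) \<in> alt_forms 1" if us: "length us = k - 1" for us
    proof -
      let ?l = "\<lambda>b. c (elementary_minors s (as @ row_coeffs idx (flats us) # as') (bs @ b # bs'))"
      have "linear ?l" using linear_compose[OF linear_elementary_right lin] by (simp add: o_def)
      from alt_forms_1I[OF this] have "(\<lambda>ws. case ws of [b] \<Rightarrow> ?l b | _ \<Rightarrow> 0) \<in> alt_forms 1" .
      moreover have "(\<lambda>ws. ?h (us @ ws)) = (\<lambda>ws. case ws of [b] \<Rightarrow> ?l b | _ \<Rightarrow> 0)"
        using us k by (auto simp: fun_eq_iff block_row_def butlast_append split: list.splits)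
      ultimately show ?thesis by simp
    qed
    show "?h (us @ v # v # ws) = 0" if "Suc (length us) = k - 1" "Suc (length ws) = 1" for us v ws
    proof -
      let ?us = "us @ [v, v]"
      have "proj k (outer (block_row ?us) (last ?us)) = flats ?us" using that by (intro proj_block) simp
      also have "\<dots> = 0" by (simp add: flats_append flip: wedge_assoc)
      finally show ?thesis using c len that by (simp add: kernel_blind_def)
    qed
  qed
  then show ?thesis using k by simp
qed

text \<open>Equal neighbours \<open>v\<close> across two blocks: elementary minors are antisymmetric in the last vectors
  of the blocks, so \<open>v\<close> can be exchanged with the last vector of the second block. The second block
  then contains \<open>v\<close> twice (for \<open>k \<ge> 2\<close> its first vector is not its last) and lies in the kernel.\<close>

lemma block_form_alt:
  assumes k2: "2 \<le> k" and c: "kernel_blind s c"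
  shows "length as = length bs \<Longrightarrow> t + length bs = s \<Longrightarrow> block_form c s as bs t \<in> alt_forms (t * k)"
proof (induction t arbitrary: as bs)
  case 0
  then show ?case by (auto simp: alt_forms_def block_form_def)
next
  case (Suc t)
  let ?h = "block_form c s as bs (Suc t)"
  have eq: "?h (us @ ws) = block_form c s (as @ [block_row us]) (bs @ [last us]) t ws" if "length us = k" for us ws
    using that by (simp add: block_form_def)
  have "?h \<in> alt_forms (k + t * k)"
  proof (rule alt_forms_appendI)
    show "?h vs = 0" if "length vs \<noteq> k + t * k" for vs using that by (simp add: block_form_def)
    show "(\<lambda>us. ?h (us @ ws)) \<in> alt_forms k" if ws: "length ws = t * k" for ws
    proof -
      have "(\<lambda>us. ?h (us @ ws)) = (\<lambda>us. if length us = k then c (elementary_minors s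
        (as @ block_row us # block_rows t ws) (bs @ last us # block_columns t ws)) else 0)"
        using ws by (auto simp: fun_eq_iff block_form_def)
      then show ?thesis using one_block_alt[OF c Suc.prems(1)] Suc.prems by simp
    qed
    show "(\<lambda>ws. ?h (us @ ws)) \<in> alt_forms (t * k)" if "length us = k" for us
      unfolding eq[OF that] using Suc.prems by (intro Suc.IH) auto
    show "?h (us @ v # v # ws) = 0" if us: "Suc (length us) = k" and ws: "Suc (length ws) = t * k" for us v ws
    proof -
      obtain t' where t: "t = Suc t'" using ws by (cases t) auto
      define us' where "us' = v # take (k - 1) ws"
      have tk: "take k (v # ws) = us'" "drop k (v # ws) = drop (k - 1) ws"
        using k2 by (cases k; simp add: us'_def)+
      have len': "length us' = k" using ws k2 t by (simp add: us'_def)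
      obtain ms w where ms: "us' = v # ms @ [w]"
        using len' k2 by (cases "take (k - 1) ws" rule: rev_cases) (auto simp: us'_def)
      let ?as = "as @ [block_row (us @ [v])]" and ?as' = "block_rows t' (drop (k - 1) ws)"
      let ?bs' = "block_columns t' (drop (k - 1) ws)"
      have "?h (us @ v # v # ws) = ?h ((us @ [v]) @ v # ws)" by simp
      also have "\<dots> = c (elementary_minors s (?as @ block_row us' # ?as') (bs @ v # w # ?bs'))"
        by (subst eq) (use us ws tk in \<open>simp_all add: block_form_def t ms\<close>)
      also have "\<dots> = - c (elementary_minors s (?as @ block_row us' # ?as') ((bs @ [w]) @ v # ?bs'))"
        using c by (simp add: elementary_swap_right[of _ _ bs v w] kernel_blind_def linear_neg)
      also have "proj k (outer (block_row us') v) = 0"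
      proof -
        have "flats (v # ms) \<in> alt_forms (k - 1)" using len' by (intro flats_alt') (simp add: ms)
        from proj_outer_coeffs[OF this, of v] show ?thesis
          using flat_wedge_sandwich[of v "flats ms" unit_form]
          by (simp add: block_row_def ms wedge_assoc butlast_append)
      qed
      then have "c (elementary_minors s (?as @ block_row us' # ?as') ((bs @ [w]) @ v # ?bs')) = 0"
        using Suc.prems t by (intro kernel_blindD[OF c]) auto
      finally show ?thesis by simp
    qed
  qed
  then show ?case by simp
qed

end

context row_numbering
begin

text \<open>The expansion of \<open>s! adj (lift \<xi>) s\<close> over \<open>s\<close>-tuples of basis forms, one factor of the tuple at a
  time, with the factors already chosen in \<open>as\<close> and \<open>bs\<close>.\<close>

primrec block_expansion ::
    "nat \<Rightarrow> 'n form \<Rightarrow> nat \<Rightarrow> (real^'N::{finite,linorder}) list \<Rightarrow> (real^'n::{finite,linorder}) list \<Rightarrow> 'N list \<Rightarrow> 'n list \<Rightarrow> real" where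
  "block_expansion s \<xi> 0 as bs = elementary_minors s as bs"
| "block_expansion s \<xi> (Suc t) as bs = (\<Sum>K\<in>multi_indices k. \<xi> (axes K) *\<^sub>R
     block_expansion s \<xi> t (as @ [block_row (axes K)]) (bs @ [last (axes K)]))"

lemma lift_eq: "lift k idx \<xi> = (\<Sum>K\<in>multi_indices k. \<xi> (axes K) *\<^sub>R outer (block_row (axes K)) (last (axes K)))"
  unfolding lift_def block_row_def
proof (intro sum.cong refl)
  fix K :: "'n list" assume "K \<in> multi_indices k"
  then have "K \<noteq> []" using k by (auto dest: length_multi_index)
  then show "\<xi> (axes K) *\<^sub>R outer (row_coeffs idx (flats (axes (butlast K)))) (axis (last K) 1)
    = \<xi> (axes K) *\<^sub>R outer (row_coeffs idx (flats (butlast (axes K)))) (last (axes K))"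
    by (simp add: map_butlast last_map)
qed

text \<open>Each step is Euler's identity for the alternating form in which the vectors \<open>bs\<close> have been
  inserted; the factors that it produces multiply to \<open>t!\<close>.\<close>

lemma block_expansion_adj:
  assumes I: "I \<in> multi_indices s" and J: "J \<in> multi_indices s"
  shows "length as = length bs \<Longrightarrow> t + length bs = s \<Longrightarrow> block_expansion s \<xi> t as bs I J
    = fact t * (flats as \<and>\<^sub>w pullback (lift k idx \<xi>) (\<lambda>vs. flats (axes J) (bs @ vs))) (axes I)"
proof (induction t arbitrary: as bs)
  case 0
  have 1: "(\<lambda>vs. flats (axes J) (bs @ vs)) = flats (axes J) bs *\<^sub>R unit_form"
    using 0 length_multi_index[OF J] alt_forms_length[OF flats_alt[of "axes J"]]
    by (auto simp: fun_eq_iff unit_form_def)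
  have 2: "pullback (lift k idx \<xi>) unit_form = unit_form"
    by (auto simp: pullback_def unit_form_def fun_eq_iff)
  show ?case
    unfolding 1 pullback_simps 2 wedge_scale_right wedge_unit
    using I J by (simp add: elementary_minors_def flats_axes_sym[OF J])
next
  case (Suc t)
  let ?X = "lift k idx \<xi>"
  define \<theta> where "\<theta> = (\<lambda>vs. flats (axes J) (bs @ vs))"
  have tail: "(\<lambda>vs. h (us @ vs)) \<in> alt_forms p" if "h \<in> alt_forms (length us + p)" for h :: "'n form" and us p
    using that
  proof (induction us arbitrary: h)
    case (Cons u us)
    from Cons.IH[of "iota u h"] Cons.prems show ?case by (simp add: iota_alt) (simp add: iota_def)
  qed simp
  have \<theta>: "\<theta> \<in> alt_forms (Suc t)"
    unfolding \<theta>_def using Suc.prems length_multi_index[OF J] by (intro tail flats_alt') simp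
  have "block_expansion s \<xi> (Suc t) as bs I J = (\<Sum>K\<in>multi_indices k. \<xi> (axes K) *
      (fact t * (flats (as @ [block_row (axes K)]) \<and>\<^sub>w pullback ?X (\<lambda>vs. flats (axes J) ((bs @ [last (axes K)]) @ vs))) (axes I)))"
    using Suc.prems by (simp add: sum_fun_apply Suc.IH del: append_assoc)
  also have "\<dots> = fact t * (flats as \<and>\<^sub>w (\<Sum>K\<in>multi_indices k. \<xi> (axes K) *\<^sub>R
      (flat (block_row (axes K)) \<and>\<^sub>w pullback ?X (iota (last (axes K)) \<theta>)))) (axes I)"
    by (simp add: linear_sum[OF linear_wedge_right] sum_fun_apply wedge_scale_right flats_append wedge_assoc
        sum_distrib_left mult_ac \<theta>_def iota_def)
  also have "\<dots> = fact (Suc t) * (flats as \<and>\<^sub>w pullback ?X \<theta>) (axes I)"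
    unfolding euler_pullback[OF \<theta> lift_eq] by (simp add: wedge_scale_right mult_ac)
  finally show ?case unfolding \<theta>_def .
qed

lemma block_expansion_full: "block_expansion s \<xi> s [] [] = fact s *\<^sub>R adj (lift k idx \<xi>) s"
proof (intro ext)
  fix I J
  have off: "block_expansion s \<xi> t as bs I J = 0" if "\<not> (I \<in> multi_indices s \<and> J \<in> multi_indices s)" for t as bs
    using that by (induction t arbitrary: as bs) (auto simp: elementary_minors_def sum_fun_apply)
  show "block_expansion s \<xi> s [] [] I J = (fact s *\<^sub>R adj (lift k idx \<xi>) s) I J"
  proof (cases "I \<in> multi_indices s \<and> J \<in> multi_indices s")
    case True
    then show ?thesis by (simp add: block_expansion_adj adj_eq_pullback)
  qed (simp add: off adj_off)
qed

text \<open>The same expansion, read through a functional that is blind to the kernel: now each summand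
  depends only on the wedge product of its blocks, and the sum is a pairing with \<open>\<xi>\<^sup>t\<close>.\<close>

lemma block_expansion_pairing:
  assumes k2: "2 \<le> k" and c: "kernel_blind s c" and \<xi>: "\<xi> \<in> alt_forms k"
  shows "length as = length bs \<Longrightarrow> t + length bs = s \<Longrightarrow> c (block_expansion s \<xi> t as bs)
    = (\<Sum>L\<in>multi_indices (t * k). block_form c s as bs t (axes L) * wedge_power \<xi> t (axes L))"
proof (induction t arbitrary: as bs)
  case 0
  have "multi_indices 0 = {[] :: 'n list}" by (auto simp: multi_indices_def)
  then show ?case by (simp add: block_form_def unit_form_def)
next
  case (Suc t)
  have lin: "linear c" using c by (simp add: kernel_blind_def)
  let ?q = "block_form c s as bs (Suc t)"
  have q: "?q \<in> alt_forms (k + t * k)"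
    using block_form_alt[OF k2 c Suc.prems] by simp
  have \<xi>t: "wedge_power \<xi> t \<in> alt_forms (t * k)" by (rule wedge_power_alt[OF \<xi>])
  have "(\<Sum>L\<in>multi_indices (Suc t * k). ?q (axes L) * wedge_power \<xi> (Suc t) (axes L))
    = (\<Sum>L\<in>multi_indices (k + t * k). ?q (axes L) *
        ((\<Sum>K\<in>multi_indices k. \<xi> (axes K) *\<^sub>R flats (axes K)) \<and>\<^sub>w wedge_power \<xi> t) (axes L))"
    by (simp flip: basis_expansion_alt[OF \<xi>])
  also have "\<dots> = (\<Sum>L\<in>multi_indices (k + t * k). \<Sum>K\<in>multi_indices k.
      \<xi> (axes K) * (?q (axes L) * (flats (axes K) \<and>\<^sub>w wedge_power \<xi> t) (axes L)))"
    unfolding linear_sum[OF linear_wedge_left] wedge_scale_left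
    by (simp add: sum_fun_apply sum_distrib_left mult.left_commute)
  also have "\<dots> = (\<Sum>K\<in>multi_indices k. \<Sum>L\<in>multi_indices (k + t * k).
      \<xi> (axes K) * (?q (axes L) * (flats (axes K) \<and>\<^sub>w wedge_power \<xi> t) (axes L)))"
    by (rule sum.swap)
  also have "\<dots> = (\<Sum>K\<in>multi_indices k. \<xi> (axes K) *
      (\<Sum>L\<in>multi_indices (k + t * k). ?q (axes L) * (flats (axes K) \<and>\<^sub>w wedge_power \<xi> t) (axes L)))"
    by (simp add: sum_distrib_left)
  also have "\<dots> = (\<Sum>K\<in>multi_indices k. \<xi> (axes K) *
      c (block_expansion s \<xi> t (as @ [block_row (axes K)]) (bs @ [last (axes K)])))"
  proof (intro sum.cong refl)
    fix K :: "'n list" assume K: "K \<in> multi_indices k"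
    then have len: "length (axes K) = k" by (simp add: length_multi_index)
    have "(\<Sum>L\<in>multi_indices (k + t * k). ?q (axes L) * (flats (axes K) \<and>\<^sub>w wedge_power \<xi> t) (axes L))
      = (\<Sum>L\<in>multi_indices (t * k). ?q (axes K @ axes L) * wedge_power \<xi> t (axes L))"
      by (rule pairing_wedge[OF q \<xi>t len])
    also have "\<dots> = (\<Sum>L\<in>multi_indices (t * k).
        block_form c s (as @ [block_row (axes K)]) (bs @ [last (axes K)]) t (axes L) * wedge_power \<xi> t (axes L))"
      using len by (intro sum.cong refl) (simp add: block_form_def length_multi_index)
    also have "\<dots> = c (block_expansion s \<xi> t (as @ [block_row (axes K)]) (bs @ [last (axes K)]))"
      using Suc.prems by (subst Suc.IH) auto
    finally show "\<xi> (axes K) * (\<Sum>L\<in>multi_indices (k + t * k). ?q (axes L) * (flats (axes K) \<and>\<^sub>w wedge_power \<xi> t) (axes L))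
      = \<xi> (axes K) * c (block_expansion s \<xi> t (as @ [block_row (axes K)]) (bs @ [last (axes K)]))" by simp
  qed
  also have "\<dots> = c (block_expansion s \<xi> (Suc t) as bs)"
    by (simp add: linear_sum[OF lin] linear_scale[OF lin])
  finally show ?case by simp
qed

text \<open>The component of order \<open>s\<close> of the linear map \<open>\<Psi>\<close> from the products of powers to the minors. The
  divisor accounts for the \<open>s!\<close> orderings in which \<open>s\<close> blocks occur in the expansion of \<open>\<xi>\<^sup>s\<close>.\<close>

definition form_to_minors :: "nat \<Rightarrow> 'n form \<Rightarrow> 'N list \<Rightarrow> 'n list \<Rightarrow> real" where
  "form_to_minors s \<zeta> = (\<Sum>L\<in>multi_indices (s * k). (\<zeta> (axes L) / fact s) *\<^sub>R
     elementary_minors s (block_rows s (axes L)) (block_columns s (axes L)))"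

lemma linear_form_to_minors: "linear (form_to_minors s)"
  by (rule linearI)
    (simp_all add: form_to_minors_def add_divide_distrib scaleR_add_left sum.distrib scaleR_sum_right)

lemma form_to_minors_in_minor_space: "form_to_minors s \<zeta> \<in> minor_space s"
  unfolding form_to_minors_def
  by (intro subspace_sum subspace_scale subspace_minor_space elementary_in_minor_space)

lemma kernel_blind_adj_lift:
  assumes k2: "2 \<le> k" and c: "kernel_blind s c" and \<xi>: "\<xi> \<in> alt_forms k"
  shows "c (adj (lift k idx \<xi>) s) = c (form_to_minors s (wedge_power \<xi> s))"
proof -
  have lin: "linear c" using c by (simp add: kernel_blind_def)
  have "fact s * c (adj (lift k idx \<xi>) s) = c (block_expansion s \<xi> s [] [])"
    by (simp add: block_expansion_full linear_scale[OF lin])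
  also have "\<dots> = (\<Sum>L\<in>multi_indices (s * k). wedge_power \<xi> s (axes L) *
      c (elementary_minors s (block_rows s (axes L)) (block_columns s (axes L))))"
    by (simp add: block_expansion_pairing[OF k2 c \<xi>] block_form_def length_multi_index mult.commute)
  also have "\<dots> = fact s * c (form_to_minors s (wedge_power \<xi> s))"
    by (simp add: form_to_minors_def linear_sum[OF lin] linear_scale[OF lin] sum_distrib_left)
  finally show ?thesis by simp
qed

section \<open>Ext. polyconvexity from polyconvexity\<close>

theorem ext_polyconvex_if_polyconvex:
  assumes k2: "2 \<le> k" and f: "polyconvex (f \<circ> (proj k :: real^'n::{finite,linorder}^'N::{finite,linorder} \<Rightarrow> _))"
  shows "ext_polyconvex k f"
proof -
  let ?m = "CARD('n) div k" and ?M = "min CARD('N) CARD('n)"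
  let ?p = "proj k :: real^'n::{finite,linorder}^'N::{finite,linorder} \<Rightarrow> 'n form"
  let ?T = "family_product ?M (minor_space :: nat \<Rightarrow> ('N list \<Rightarrow> 'n list \<Rightarrow> real) set)"
  obtain G where G: "convex_on ?T G" and fG: "\<And>X. f (?p X) = G (family ?M (adj X))"
    using f by (auto simp: polyconvex_def)
  have T: "subspace ?T" by (intro subspace_family_product subspace_minor_space)
  let ?U = "invariant_directions ?T G"
  have U: "subspace ?U" by (rule subspace_invariant_directions[OF T])
  have direction: "single s (adj (Y + outer a b) s - adj Y s) \<in> ?U"
    if ker: "?p (outer a b) = 0" and s: "s \<in> {1..?M}" for Y a b s
  proof -
    define D where "D s = adj (Y + outer a b) s - adj Y s" for s
    have D: "D s \<in> minor_space s" for s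
      unfolding D_def by (intro subspace_diff subspace_minor_space adj_in_minor_space)
    \<comment> \<open>Scaling \<open>Y\<close> by \<open>c\<close> multiplies the component of order \<open>s\<close> by \<open>c\<^sup>s\<close>; varying \<open>c\<close> then separates
      the orders.\<close>
    have mem: "family ?M (\<lambda>s. c ^ s *\<^sub>R D s) \<in> ?U" for c :: real
    proof (rule invariant_direction_if_constant_on_line[OF T G])
      show "family ?M (adj (c *\<^sub>R Y)) \<in> ?T" by (intro family_in_product adj_in_minor_space)
      show "family ?M (\<lambda>s. c ^ s *\<^sub>R D s) \<in> ?T"
        by (intro family_in_product subspace_scale[OF subspace_minor_space] D)
      fix t :: real
      have "family ?M (adj (c *\<^sub>R Y)) + t *\<^sub>R family ?M (\<lambda>s. c ^ s *\<^sub>R D s)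
          = family ?M (adj (c *\<^sub>R (Y + outer (t *\<^sub>R a) b)))"
        unfolding adj_scale adj_affine[of Y t] D_def
        by (auto simp: family_def fun_eq_iff adj_scale algebra_simps)
      moreover have "?p (c *\<^sub>R (Y + outer (t *\<^sub>R a) b)) = ?p (c *\<^sub>R Y)"
        using ker by (simp add: linear_add[OF linear_proj] linear_scale[OF linear_proj] outer_scale_left)
      ultimately show "G (family ?M (adj (c *\<^sub>R Y)) + t *\<^sub>R family ?M (\<lambda>s. c ^ s *\<^sub>R D s)) = G (family ?M (adj (c *\<^sub>R Y)))"
        by (simp flip: fG)
    qed
    have "(\<Sum>s\<le>?M. c ^ s *\<^sub>R (if s = 0 then 0 else single s (D s))) \<in> ?U" for c :: real
    proof -
      have "(\<Sum>s\<le>?M. c ^ s *\<^sub>R (if s = 0 then 0 else single s (D s))) = (\<Sum>s\<in>{1..?M}. single s (c ^ s *\<^sub>R D s))"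
        by (rule sum.mono_neutral_cong_right) (auto simp: linear_scale[OF linear_single])
      then show ?thesis using mem[of c] by (simp add: family_eq_sum_single)
    qed
    from polynomial_coefficients_in_subspace[OF U this, of s] s show ?thesis by (simp add: D_def)
  qed
  obtain P :: "(nat \<Rightarrow> 'N list \<Rightarrow> 'n list \<Rightarrow> real) \<Rightarrow> nat \<Rightarrow> 'N list \<Rightarrow> 'n list \<Rightarrow> real"
    where P: "linear P" "\<And>u. P u = 0 \<longleftrightarrow> u \<in> ?U"
    using projection_off_subspace[OF U] by blast
  have blind: "kernel_blind s (\<lambda>A. P (single s A) s' I J)" if s: "s \<in> {1..?M}" for s s' I J
    unfolding kernel_blind_def
  proof (intro conjI allI impI)
    have lin: "linear (\<lambda>A. P (single s A))" using linear_compose[OF linear_single P(1)] by (simp add: o_def)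
    show "linear (\<lambda>A. P (single s A) s' I J)"
      by (rule linearI) (simp_all add: linear_add[OF lin] linear_scale[OF lin])
    fix as as' :: "(real^'N::{finite,linorder}) list" and bs bs' :: "(real^'n::{finite,linorder}) list" and a b
    assume len: "length as = length bs" "length as' = length bs'" "Suc (length bs + length bs') = s"
      and ker: "?p (outer a b) = 0"
    let ?Y = "outers (as @ as') (bs @ bs') :: real^'n::{finite,linorder}^'N::{finite,linorder}"
    \<comment> \<open>\<open>?Y\<close> is a sum of \<open>s - 1\<close> rank-one matrices, so its own minors of order \<open>s\<close> vanish.\<close>
    have "adj (?Y + outer a b) s - adj ?Y s = elementary_minors s (as @ a # as') (bs @ b # bs')"
      using len by (simp add: adj_outers_few adj_outers flip: outers_insert)
    with direction[OF ker s, of ?Y] have "P (single s (elementary_minors s (as @ a # as') (bs @ b # bs'))) = 0"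
      unfolding P(2) by simp
    then show "P (single s (elementary_minors s (as @ a # as') (bs @ b # bs'))) s' I J = 0" by simp
  qed
  have same: "G (family ?M (\<lambda>s. form_to_minors s (wedge_power \<xi> s))) = f \<xi>" if \<xi>: "\<xi> \<in> alt_forms k" for \<xi>
  proof -
    let ?A = "family ?M (adj (lift k idx \<xi>))" and ?B = "family ?M (\<lambda>s. form_to_minors s (wedge_power \<xi> s))"
    have "P (single s (adj (lift k idx \<xi>) s)) = P (single s (form_to_minors s (wedge_power \<xi> s)))" if "s \<in> {1..?M}" for s
      using kernel_blind_adj_lift[OF k2 blind[OF that] \<xi>] by (intro ext)
    then have "P ?A = P ?B" by (simp add: family_eq_sum_single linear_sum[OF P(1)])
    then have d: "?B - ?A \<in> ?U" by (simp add: linear_diff[OF P(1)] flip: P(2))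
    have "?A \<in> ?T" by (intro family_in_product adj_in_minor_space)
    then have "G (?A + 1 *\<^sub>R (?B - ?A)) = G ?A" using d unfolding invariant_directions_def by blast
    then show ?thesis using fG[of "lift k idx \<xi>"] by (simp add: proj_lift[OF \<xi>])
  qed
  let ?L = "\<lambda>\<tau>. family ?M (\<lambda>s. form_to_minors s (\<tau> s))"
  have "convex_on (family_product ?m (\<lambda>s. alt_forms (s * k))) (\<lambda>\<tau>. G (?L \<tau>))"
  proof (rule convex_on_linear_compose[OF _ _ _ G])
    show "linear ?L" by (intro linear_family linear_form_to_minors)
    show "convex (family_product ?m (\<lambda>s. alt_forms (s * k) :: 'n form set))"
      by (intro subspace_imp_convex subspace_family_product subspace_alt_forms)
    show "?L ` family_product ?m (\<lambda>s. alt_forms (s * k)) \<subseteq> ?T"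
      by (intro image_subsetI family_in_product form_to_minors_in_minor_space)
  qed
  moreover have "f \<xi> = G (?L (family ?m (wedge_power \<xi>)))" if "\<xi> \<in> alt_forms k" for \<xi>
  proof -
    \<comment> \<open>Beyond the highest power there are no increasing multiindices left, so \<open>form_to_minors\<close> vanishes
      where \<open>family ?m\<close> truncates.\<close>
    have zero: "form_to_minors s \<zeta> = 0" if "\<not> s \<le> ?m" for s and \<zeta> :: "'n form"
    proof -
      have "CARD('n) < s * k" using that k by (simp add: not_le div_less_iff_less_mult)
      then have "card (multi_indices (s * k) :: 'n list set) = 0" by (simp add: card_multi_indices)
      then show ?thesis by (simp add: form_to_minors_def)
    qed
    have "?L (family ?m (wedge_power \<xi>)) = ?L (wedge_power \<xi>)"
      using zero by (auto simp: family_def fun_eq_iff)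
    then show ?thesis using same[OF that] by simp
  qed
  ultimately show ?thesis unfolding ext_polyconvex_def by blast
qed

end

section \<open>The three equivalences\<close>

theorem theorem1p1:
  fixes f :: "'n::{finite,linorder} form \<Rightarrow> real"
    and k :: nat
    and \<pi> :: "real^'n::{finite,linorder}^'N::{finite,linorder} \<Rightarrow> 'n form"
  assumes "2 \<le> k" and "k \<le> CARD('n)"
    and "CARD('N) = CARD('n) choose (k - 1)"
    and "\<pi> = proj k"
  shows "(ext_one_convex k f \<longleftrightarrow> rank_one_convex (f \<circ> \<pi>)) \<and>
         (ext_quasiconvex k f \<longleftrightarrow> quasiconvex (f \<circ> \<pi>)) \<and>
         (ext_polyconvex k f \<longleftrightarrow> polyconvex (f \<circ> \<pi>))"
proof -
  interpret row_numbering k "row_index k :: 'N \<Rightarrow> 'n list"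
    by unfold_locales (use assms(1) bij_row_index[OF assms(3)] in simp_all)
  have "CARD('n) \<le> CARD('N)"
    unfolding assms(3) using assms(1,2) by (intro upper_le_binomial) auto
  then have "CARD('n) div k \<le> min CARD('N) CARD('n)"
    using div_le_dividend[of "CARD('n)" k] by simp
  then show ?thesis
    using ext_one_convex_iff_rank_one_convex[of f] ext_quasiconvex_iff_quasiconvex[of f]
      polyconvex_if_ext_polyconvex[of f] ext_polyconvex_if_polyconvex[OF assms(1), of f] assms(4)
    by blast
qed

end
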